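(* Let $n\ge1$ and let $f$ be an entire transcendental function on $\mathbb{C}^n$ of finite order. Suppose that $P\in\mathcal{R}^n[w]$ and that $P(f)=Re^p$ is a non-trivial invertible function in $\mathcal{M}_0^n$, where $R\in\mathcal{R}^n$ and $p$ is entire on $\mathbb{C}^n$. Then $p$ is a polynomial, $p\in\mathcal{P}^n$, with $\deg p\ge 1$, and there exist an integer $m\ge1$ and $p_1,p_2\in\mathcal{R}^n$ such that $$P(w)=R\,p_2^m\,(w+p_1)^m,\qquad f=p_2^{-1}e^{p/m}-p_1.$$
   Context: $\mathcal{P}^n$ and $\mathcal{R}^n$ are the spaces of polynomials, respectively rational functions, on $\mathbb{C}^n$; $\mathcal{R}^n[w]$ is the algebra of polynomials in one variable $w$ with coefficients in $\mathcal{R}^n$. $\mathcal{M}_0^n$ is the algebra of meromorphic functions on $\mathbb{C}^n$ of the form $h/q$ with $h$ entire and $q\in\mathcal{P}^n$, $q\not\equiv0$ (equivalently, meromorphic functions with algebraic polar variety). The invertible elements of $\mathcal{M}_0^n$ are the functions $Re^h$ with $R\in\mathcal{R}^n$, $R\not\equiv0$, and $h$ entire; such $Re^h$ is called a non-trivial invertible function in $\mathcal{M}_0^n$ if $h$ is not constant. An entire function is transcendental if it is not a polynomial. An entire function $f$ on $\mathbb{C}^n$ has finite order if there are constants $C,\rho>0$ with $|f(z)|\le Ce^{|z|^{\rho}}$ for all $z\in\mathbb{C}^n$. *)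

theory Defs
  imports
    "HOL-Complex_Analysis.Complex_Analysis"
    "HOL-Computational_Algebra.Computational_Algebra"
begin

(* The space C^n is rendered as complex ^ 'n for an arbitrary finite (hence nonempty) index
   type 'n; the norm on this type is the Euclidean one. *)

section \<open>Entire functions of several complex variables\<close>

definition entire :: "(complex ^ 'n \<Rightarrow> complex) \<Rightarrow> bool" where
  "entire f \<longleftrightarrow>
     (\<forall>z. \<exists>D. (f has_derivative D) (at z) \<and> (\<forall>c v. D (c *s v) = c * D v))"

definition finite_order :: "(complex ^ 'n \<Rightarrow> complex) \<Rightarrow> bool" where
  "finite_order f \<longleftrightarrow>
     (\<exists>C>0. \<exists>\<rho>>0. \<forall>z. cmod (f z) \<le> C * exp (norm z powr \<rho>))"

section \<open>Polynomials on \<open>\<complex>\<^sup>n\<close>\<close>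

definition multi_indices :: "nat \<Rightarrow> ('n::finite \<Rightarrow> nat) set" where
  "multi_indices d = {\<alpha>. (\<Sum>i\<in>UNIV. \<alpha> i) \<le> d}"

(* Guards the sums over multi_indices below against the convention that a sum over an
   infinite set is 0. *)
lemma finite_multi_indices: "finite (multi_indices d :: ('n::finite \<Rightarrow> nat) set)"
proof (rule finite_subset)
  show "(multi_indices d :: ('n \<Rightarrow> nat) set) \<subseteq> (\<Pi>\<^sub>E i\<in>UNIV. {..d})"
  proof
    fix \<alpha> :: "'n \<Rightarrow> nat"
    assume "\<alpha> \<in> multi_indices d"
    then have "(\<Sum>i\<in>UNIV. \<alpha> i) \<le> d" by (simp add: multi_indices_def)
    moreover have "\<alpha> i \<le> (\<Sum>i\<in>UNIV. \<alpha> i)" for i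
      by (rule member_le_sum) auto
    ultimately show "\<alpha> \<in> (\<Pi>\<^sub>E i\<in>UNIV. {..d})"
      by (auto intro: order_trans)
  qed
  show "finite (\<Pi>\<^sub>E i\<in>(UNIV :: 'n set). {..d})"
    by (rule finite_PiE) auto
qed

definition poly_deg_le :: "nat \<Rightarrow> (complex ^ 'n \<Rightarrow> complex) \<Rightarrow> bool" where
  "poly_deg_le d f \<longleftrightarrow>
     (\<exists>c. \<forall>z. f z = (\<Sum>\<alpha>\<in>multi_indices d. c \<alpha> * (\<Prod>i\<in>UNIV. (z $ i) ^ \<alpha> i)))"

definition polynomial_fun :: "(complex ^ 'n \<Rightarrow> complex) \<Rightarrow> bool" where
  "polynomial_fun f \<longleftrightarrow> (\<exists>d. poly_deg_le d f)"

(* Total degree; meaningful only if f is a polynomial. The zero polynomial gets degree 0. *)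
definition total_degree :: "(complex ^ 'n \<Rightarrow> complex) \<Rightarrow> nat" where
  "total_degree f = (LEAST d. poly_deg_le d f)"

definition transcendental :: "(complex ^ 'n \<Rightarrow> complex) \<Rightarrow> bool" where
  "transcendental f \<longleftrightarrow> entire f \<and> \<not> polynomial_fun f"

section \<open>The integral domain of entire functions\<close>

lemma entire_const: "entire (\<lambda>_. c)"
  unfolding entire_def by (auto intro!: exI[of _ "\<lambda>_. 0"] derivative_eq_intros)

lemma entire_add:
  assumes "entire f" "entire g" shows "entire (\<lambda>z. f z + g z)"
  unfolding entire_def
proof
  fix z
  obtain D E where "(f has_derivative D) (at z)" "\<forall>c v. D (c *s v) = c * D v"
    "(g has_derivative E) (at z)" "\<forall>c v. E (c *s v) = c * E v"
    using assms unfolding entire_def by blast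
  then show "\<exists>F. ((\<lambda>z. f z + g z) has_derivative F) (at z) \<and> (\<forall>c v. F (c *s v) = c * F v)"
    by (intro exI[of _ "\<lambda>v. D v + E v"]) (auto intro: has_derivative_add simp: algebra_simps)
qed

lemma entire_mult:
  assumes "entire f" "entire g" shows "entire (\<lambda>z. f z * g z)"
  unfolding entire_def
proof
  fix z
  obtain D E where "(f has_derivative D) (at z)" "\<forall>c v. D (c *s v) = c * D v"
    "(g has_derivative E) (at z)" "\<forall>c v. E (c *s v) = c * E v"
    using assms unfolding entire_def by blast
  then show "\<exists>F. ((\<lambda>z. f z * g z) has_derivative F) (at z) \<and> (\<forall>c v. F (c *s v) = c * F v)"
    by (intro exI[of _ "\<lambda>v. f z * E v + D v * g z"])
       (auto intro!: has_derivative_mult simp: distrib_left)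
qed

lemma entire_uminus: "entire f \<Longrightarrow> entire (\<lambda>z. - f z)"
  using entire_mult[OF entire_const[of "-1"], of f] by simp

lemma entire_diff: "entire f \<Longrightarrow> entire g \<Longrightarrow> entire (\<lambda>z. f z - g z)"
  using entire_add[OF _ entire_uminus, of f g] by simp

lemma entire_on_line:
  fixes f :: "complex ^ 'n \<Rightarrow> complex"
  assumes "entire f"
  shows "(\<lambda>t. f (a + t *s v)) holomorphic_on UNIV"
  unfolding holomorphic_on_def field_differentiable_def
proof
  fix t :: complex
  obtain D where D: "(f has_derivative D) (at (a + t *s v))" "\<forall>c v. D (c *s v) = c * D v"
    using assms unfolding entire_def by blast
  have lin: "bounded_linear (\<lambda>s. s *s v)"
    by (intro linear_conv_bounded_linear[THEN iffD1] linearI)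
       (simp_all add: vec_eq_iff algebra_simps)
  have "((\<lambda>t. a + t *s v) has_derivative (\<lambda>s. s *s v)) (at t)"
    using has_derivative_add[OF has_derivative_const bounded_linear_imp_has_derivative[OF lin]]
    by simp
  from has_derivative_compose[OF this D(1)]
  have "((\<lambda>t. f (a + t *s v)) has_derivative (\<lambda>s. D v * s)) (at t)"
    using D(2) by (simp add: mult.commute)
  then show "\<exists>f'. ((\<lambda>t. f (a + t *s v)) has_field_derivative f') (at t within UNIV)"
    unfolding has_field_derivative_def by blast
qed

lemma entire_no_zero_divisors:
  fixes f g :: "complex ^ 'n \<Rightarrow> complex"
  assumes "entire f" "entire g" "\<And>z. f z * g z = 0"
  shows "f = (\<lambda>_. 0) \<or> g = (\<lambda>_. 0)"
proof (rule ccontr)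
  assume "\<not> ?thesis"
  then obtain a b where a: "f a \<noteq> 0" and b: "g b \<noteq> 0" by (auto simp: fun_eq_iff)
  define F G where "F = (\<lambda>t. f (a + t *s (b - a)))" and "G = (\<lambda>t. g (a + t *s (b - a)))"
  have hF: "F holomorphic_on UNIV" and hG: "G holomorphic_on UNIV"
    unfolding F_def G_def using assms(1,2) by (blast intro: entire_on_line)+
  have F0: "F 0 \<noteq> 0" using a by (simp add: F_def)
  have G1: "G 1 \<noteq> 0" using b by (simp add: G_def)
  have "open (F -` (-{0}))"
    by (intro open_vimage) (use hF holomorphic_on_imp_continuous_on in auto)
  moreover have "G t = 0" if "t \<in> F -` (-{0})" for t
    using that assms(3)[of "a + t *s (b - a)"] by (auto simp: F_def G_def)
  ultimately have "G 1 = 0"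
    using analytic_continuation_open[of "F -` (-{0})" UNIV G "\<lambda>_. 0" 1] hG F0 by auto
  with G1 show False by simp
qed

typedef ('n::finite) entire_fun = "{f :: complex ^ 'n \<Rightarrow> complex. entire f}"
  using entire_const by blast

setup_lifting type_definition_entire_fun

instantiation entire_fun :: (finite) idom
begin

lift_definition zero_entire_fun :: "'a entire_fun" is "\<lambda>_. 0" by (rule entire_const)
lift_definition one_entire_fun :: "'a entire_fun" is "\<lambda>_. 1" by (rule entire_const)
lift_definition plus_entire_fun :: "'a entire_fun \<Rightarrow> 'a entire_fun \<Rightarrow> 'a entire_fun"
  is "\<lambda>f g z. f z + g z" by (rule entire_add)
lift_definition minus_entire_fun :: "'a entire_fun \<Rightarrow> 'a entire_fun \<Rightarrow> 'a entire_fun"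
  is "\<lambda>f g z. f z - g z" by (rule entire_diff)
lift_definition uminus_entire_fun :: "'a entire_fun \<Rightarrow> 'a entire_fun"
  is "\<lambda>f z. - f z" by (rule entire_uminus)
lift_definition times_entire_fun :: "'a entire_fun \<Rightarrow> 'a entire_fun \<Rightarrow> 'a entire_fun"
  is "\<lambda>f g z. f z * g z" by (rule entire_mult)

instance
proof
  fix f g :: "'a entire_fun"
  assume "f \<noteq> 0" "g \<noteq> 0"
  then show "f * g \<noteq> 0"
    by transfer (use entire_no_zero_divisors in \<open>auto simp: fun_eq_iff\<close>)
qed (transfer; auto simp: algebra_simps fun_eq_iff)+

end

section \<open>Meromorphic and rational functions\<close>

(* The field of fractions of the ring of entire functions. Since every meromorphic function on
   C^n is a quotient of two entire functions, this is the field of all meromorphic functions on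
   C^n. The rational functions, and the functions h/q with h entire and q a nonzero polynomial,
   are embedded in it. *)
type_synonym 'n mero = "'n entire_fun fract"

(* The entire function f viewed as a meromorphic function; only meaningful if f is entire. *)
definition mero_of :: "(complex ^ 'n \<Rightarrow> complex) \<Rightarrow> 'n::finite mero" where
  "mero_of f = Fraction_Field.Fract (Abs_entire_fun f) 1"

definition rational_funs :: "'n::finite mero set" where
  "rational_funs =
     {mero_of a / mero_of b | a b. polynomial_fun a \<and> polynomial_fun b \<and> b \<noteq> (\<lambda>_. 0)}"

lemma mero_of_eq_iff: "entire f \<Longrightarrow> entire g \<Longrightarrow> mero_of f = mero_of g \<longleftrightarrow> f = g"
  by (simp add: mero_of_def eq_fract Abs_entire_fun_inject)

lemma entire_prod: "(\<And>i. i \<in> A \<Longrightarrow> entire (f i)) \<Longrightarrow> entire (\<lambda>z. \<Prod>i\<in>A. f i z)"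
  by (induction A rule: infinite_finite_induct) (auto intro: entire_const entire_mult)

lemma entire_sum: "(\<And>i. i \<in> A \<Longrightarrow> entire (f i)) \<Longrightarrow> entire (\<lambda>z. \<Sum>i\<in>A. f i z)"
  by (induction A rule: infinite_finite_induct) (auto intro: entire_const entire_add)

lemma entire_component: "entire (\<lambda>z. z $ i)"
  unfolding entire_def
  by (intro allI exI[of _ "\<lambda>v. v $ i"])
     (auto intro: bounded_linear_imp_has_derivative bounded_linear_vec_nth)

lemma entire_power: "entire f \<Longrightarrow> entire (\<lambda>z. f z ^ k)"
  by (induction k) (auto intro: entire_const entire_mult)

lemma entire_polynomial_fun:
  assumes "polynomial_fun f" shows "entire f"
proof -
  obtain d c where "f = (\<lambda>z. \<Sum>\<alpha>\<in>multi_indices d. c \<alpha> * (\<Prod>i\<in>UNIV. (z $ i) ^ \<alpha> i))"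
    using assms unfolding polynomial_fun_def poly_deg_le_def by blast
  then show ?thesis
    by (simp add: entire_sum entire_mult entire_const entire_prod entire_power entire_component)
qed

end

theory Submission
  imports Defs
begin

text \<open>
  A common denominator and a Tschirnhaus shift replace \<open>f\<close> by an entire \<open>g = q (f + p\<^sub>1)\<close>
  satisfying \<open>T(g) = g\<^sup>D + \<Sum>\<^bsub>i < D - 1\<^esub> b\<^sub>i g\<^sup>i = S e\<^sup>p\<close> with polynomials \<open>b\<^sub>i\<close> and \<open>S\<close>. Dividing by \<open>S\<close> costs only a
  bounded change of the argument, so \<open>Re p\<close> grows at most polynomially and \<open>p\<close> is a polynomial.

  On a complex line where \<open>S \<noteq> 0\<close> and \<open>p\<close> is not constant, put \<open>\<tau> = S' + S p'\<close> and
  \<open>G = D S g' - \<tau> g\<close>. Differentiating \<open>T(g) = S e\<^sup>p\<close> gives \<open>\<partial>T/\<partial>w(g) G = B(g)\<close> with \<open>B\<close> of degree at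
  most \<open>D - 2\<close> in \<open>g\<close>. Hence \<open>G\<close> is bounded where \<open>g\<close> is large, as in Clunie's lemma. Where
  \<open>g\<close> is small, \<open>S e\<^sup>p\<close> and therefore \<open>g\<close> remain polynomially bounded on a small disc, and Cauchy's
  inequality bounds \<open>g'\<close>. So \<open>G\<close> is a polynomial; as \<open>g\<close> is not algebraic, \<open>G = 0\<close> and \<open>B = 0\<close>,
  and comparing degrees in \<open>(D - i) \<tau> b\<^sub>i = D S b\<^sub>i'\<close> yields \<open>b\<^sub>i = 0\<close>. Every point lies on such a line,
  so \<open>g\<^sup>D = S e\<^sup>p\<close> everywhere, and \<open>h = g e\<^bsup>-p/D\<^esup>\<close> is a polynomial because \<open>h\<^sup>D = S\<close>.
\<close>

section \<open>Entire functions of one variable and polynomial growth\<close>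

text \<open>The codomain may be real or complex, so that real majorants obey the same closure rules
  as the functions they bound. Since \<open>1 + norm z\<close> is at least 1, exponents can be
  enlarged freely.\<close>

definition poly_growth :: "('a::real_normed_vector \<Rightarrow> 'b::real_normed_field) \<Rightarrow> bool" where
  "poly_growth F \<longleftrightarrow> (\<exists>C N. \<forall>z. norm (F z) \<le> C * (1 + norm z) ^ N)"

lemma poly_growthE:
  assumes "poly_growth F"
  obtains C N where "C \<ge> 1" "\<And>z. norm (F z) \<le> C * (1 + norm z) ^ N"
proof -
  obtain C N where *: "\<And>z. norm (F z) \<le> C * (1 + norm z) ^ N"
    using assms unfolding poly_growth_def by blast
  have "norm (F z) \<le> max C 1 * (1 + norm z) ^ N" for z
    using *[of z] by (rule order_trans) (intro mult_right_mono, auto)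
  then show ?thesis using that[of "max C 1" N] by simp
qed

lemma poly_growth_mono:
  assumes "poly_growth B" "\<And>z. norm (F z) \<le> norm (B z)"
  shows "poly_growth F"
  using assms unfolding poly_growth_def by (meson order_trans)

lemma poly_growth_const: "poly_growth (\<lambda>_. c)"
  unfolding poly_growth_def by (intro exI[of _ "norm c"] exI[of _ 0]) simp

lemma poly_growth_norm: "poly_growth F \<Longrightarrow> poly_growth (\<lambda>z. norm (F z))"
  unfolding poly_growth_def by simp

lemma poly_growth_norm_arg: "poly_growth (\<lambda>z. norm z)"
  unfolding poly_growth_def by (intro exI[of _ 1] exI[of _ 1]) simp

lemma poly_growth_ident: "poly_growth (\<lambda>z. z)"
  unfolding poly_growth_def by (intro exI[of _ 1] exI[of _ 1]) simp

lemma poly_growth_add: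
  assumes "poly_growth F" "poly_growth G"
  shows "poly_growth (\<lambda>z. F z + G z)"
proof -
  obtain A M where A: "A \<ge> 1" "\<And>z. norm (F z) \<le> A * (1 + norm z) ^ M"
    using assms(1) poly_growthE by blast
  obtain B N where B: "B \<ge> 1" "\<And>z. norm (G z) \<le> B * (1 + norm z) ^ N"
    using assms(2) poly_growthE by blast
  have "norm (F z + G z) \<le> (A + B) * (1 + norm z) ^ (M + N)" for z
  proof -
    have "norm (F z + G z) \<le> A * (1 + norm z) ^ M + B * (1 + norm z) ^ N"
      using norm_triangle_le add_mono[OF A(2) B(2)] by blast
    also have "\<dots> \<le> A * (1 + norm z) ^ (M + N) + B * (1 + norm z) ^ (M + N)"
      using A(1) B(1) by (intro add_mono mult_left_mono power_increasing) auto
    finally show ?thesis by (simp add: distrib_right)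
  qed
  then show ?thesis unfolding poly_growth_def by blast
qed

lemma poly_growth_mult:
  assumes "poly_growth F" "poly_growth G"
  shows "poly_growth (\<lambda>z. F z * G z)"
proof -
  obtain A M where A: "A \<ge> 1" "\<And>z. norm (F z) \<le> A * (1 + norm z) ^ M"
    using assms(1) poly_growthE by blast
  obtain B N where B: "B \<ge> 1" "\<And>z. norm (G z) \<le> B * (1 + norm z) ^ N"
    using assms(2) poly_growthE by blast
  have "norm (F z * G z) \<le> (A * B) * (1 + norm z) ^ (M + N)" for z
  proof -
    have "norm (F z * G z) \<le> (A * (1 + norm z) ^ M) * (B * (1 + norm z) ^ N)"
      unfolding norm_mult using A B by (intro mult_mono) auto
    then show ?thesis by (simp add: power_add mult_ac)
  qed
  then show ?thesis unfolding poly_growth_def by blast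
qed

lemma poly_growth_power: "poly_growth F \<Longrightarrow> poly_growth (\<lambda>z. F z ^ k)"
  by (induction k) (auto intro: poly_growth_mult poly_growth_const)

lemma poly_growth_sum:
  "(\<And>i. i \<in> I \<Longrightarrow> poly_growth (F i)) \<Longrightarrow> poly_growth (\<lambda>z. \<Sum>i\<in>I. F i z)"
  by (induction I rule: infinite_finite_induct) (auto intro: poly_growth_add poly_growth_const)

lemma poly_growth_prod:
  "(\<And>i. i \<in> I \<Longrightarrow> poly_growth (F i)) \<Longrightarrow> poly_growth (\<lambda>z. \<Prod>i\<in>I. F i z)"
  by (induction I rule: infinite_finite_induct) (auto intro: poly_growth_mult poly_growth_const)

lemma poly_growth_poly: "poly_growth (\<lambda>z. poly u z)"
  unfolding poly_altdef
  by (intro poly_growth_sum poly_growth_mult poly_growth_const poly_growth_power poly_growth_ident)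

lemmas poly_growth_intros = poly_growth_const poly_growth_norm poly_growth_norm_arg
  poly_growth_ident poly_growth_add poly_growth_mult poly_growth_power poly_growth_sum
  poly_growth_prod poly_growth_poly

text \<open>For real x >= 0 and k >= 1 one has x <= 1 + x^k. This serves to bound the root
  \<open>h\<close> of the polynomial \<open>S\<close> at the end of the main proof.\<close>

lemma poly_growth_root:
  assumes "poly_growth S" "\<And>z. h z ^ k = S z" "k > 0"
  shows "poly_growth h"
proof (rule poly_growth_mono[where B = "\<lambda>z. 1 + norm (S z)"])
  show "poly_growth (\<lambda>z. 1 + norm (S z))" by (intro poly_growth_intros assms)
  fix z
  have "norm (h z) \<le> 1 + norm (h z) ^ k"
  proof (cases "norm (h z) \<le> 1")
    case False
    then have "norm (h z) ^ 1 \<le> norm (h z) ^ k"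
      using assms(3) by (intro power_increasing) auto
    then show ?thesis by simp
  qed (simp add: add_increasing2)
  then show "norm (h z) \<le> norm (1 + norm (S z))"
    by (simp flip: assms(2) add: norm_power)
qed

section \<open>Liouville's theorem and algebraic relations in one variable\<close>

lemma entire_poly_growth_at_infinity:
  fixes F :: "complex \<Rightarrow> complex"
  assumes F: "F holomorphic_on UNIV"
    and B: "poly_growth (B :: complex \<Rightarrow> real)"
    and ev: "\<And>z. norm z \<ge> A \<Longrightarrow> norm (F z) \<le> B z"
  obtains u where "\<And>z. F z = poly u z"
proof -
  obtain C N where C: "C \<ge> 1" "\<And>z. norm (B z) \<le> C * (1 + norm z) ^ N"
    using B poly_growthE by blast
  \<comment> \<open>From radius 1 on, \<open>1 + norm z\<close> is at most
    \<open>2 * norm z\<close>; this gives the pure power required by Liouville's theorem.\<close>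
  have "norm (F z) \<le> C * 2 ^ N * norm z ^ N" if "norm z \<ge> max A 1" for z
  proof -
    have "norm (F z) \<le> C * (1 + norm z) ^ N"
      using ev[of z] that C(2)[of z] by simp
    also have "\<dots> \<le> C * (2 * norm z) ^ N"
      using C(1) that by (intro mult_left_mono power_mono) auto
    finally show ?thesis by (simp add: power_mult_distrib)
  qed
  then have "F z = (\<Sum>k\<le>N. (deriv ^^ k) F 0 / fact k * z ^ k)" for z
    by (rule Liouville_polynomial[OF F])
  then have "F z = poly (\<Sum>k\<le>N. monom ((deriv ^^ k) F 0 / fact k) k) z" for z
    by (simp add: poly_sum poly_monom)
  then show ?thesis using that by blast
qed

text \<open>A nonconstant polynomial tends to infinity, and a nonzero constant is its own lower
  bound. Hence dividing by \<open>u\<close> far from the origin costs only a constant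
  factor.\<close>

lemma poly_eventually_ge:
  fixes u :: "complex poly"
  assumes "u \<noteq> 0"
  obtains A c where "c > 0" "\<And>z. norm z \<ge> A \<Longrightarrow> norm (poly u z) \<ge> c"
proof (cases "degree u = 0")
  case True
  then obtain a where "u = [:a:]" using degree_eq_zeroE by blast
  then show ?thesis using that[of "norm a" 0] assms by simp
next
  case False
  have "\<forall>\<^sub>F z in at_infinity. norm (poly u z) \<ge> 1"
    using filterlim_poly_at_infinity[of u] False by (auto simp: filterlim_at_infinity[of 0])
  then show ?thesis using that[of 1] by (auto simp: eventually_at_infinity)
qed

text \<open>Induction on the degree. If the leading coefficient were nonzero, division of the
  relation by \<open>g t ^ n\<close> would bound \<open>g\<close> polynomially outside a disc, and
  Liouville's theorem would make \<open>g\<close> a polynomial.\<close>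

lemma algebraic_entire_imp_polynomial:
  fixes g :: "complex \<Rightarrow> complex" and c :: "nat \<Rightarrow> complex poly"
  assumes g: "g holomorphic_on UNIV" and ng: "\<not> poly_growth g"
    and eq: "\<And>t. (\<Sum>i\<le>n. poly (c i) t * g t ^ i) = 0"
  shows "i \<le> n \<Longrightarrow> c i = 0"
  using eq
proof (induction n arbitrary: i)
  case 0
  then have "poly (c 0) t = 0" for t by auto
  then have "c 0 = 0" using poly_all_0_iff_0 by blast
  then show ?case using 0 by simp
next
  case (Suc n)
  have "c (Suc n) = 0"
  proof (rule ccontr)
    assume nz: "c (Suc n) \<noteq> 0"
    obtain A a where A: "a > 0" "\<And>z. norm z \<ge> A \<Longrightarrow> norm (poly (c (Suc n)) z) \<ge> a"
      using poly_eventually_ge[OF nz] by blast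
    \<comment> \<open>The summand 1 covers the points where \<open>norm (g z)\<close> is at most 1;
      \<open>inverse a\<close> pays for the division by the leading coefficient.\<close>
    define B where "B = (\<lambda>z. 1 + (\<Sum>i\<le>n. norm (poly (c i) z)) * inverse a)"
    have bound: "norm (g z) \<le> B z" if z: "norm z \<ge> A" for z
    proof (cases "norm (g z) \<le> 1")
      case True
      have "(\<Sum>i\<le>n. norm (poly (c i) z)) * inverse a \<ge> 0"
        using A(1) by (intro mult_nonneg_nonneg sum_nonneg) auto
      then show ?thesis using True by (simp add: B_def)
    next
      case False
      have "poly (c (Suc n)) z * g z ^ Suc n = - (\<Sum>i\<le>n. poly (c i) z * g z ^ i)"
        using Suc.prems(2)[of z] by (simp add: add_eq_0_iff)
      then have "norm (poly (c (Suc n)) z) * norm (g z) ^ Suc n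
          = norm (\<Sum>i\<le>n. poly (c i) z * g z ^ i)"
        by (metis norm_minus_cancel norm_mult norm_power)
      also have "\<dots> \<le> (\<Sum>i\<le>n. norm (poly (c i) z) * norm (g z) ^ n)"
        using False unfolding norm_mult norm_power
        by (intro sum_norm_le) (auto simp: norm_mult norm_power intro!: mult_left_mono power_increasing)
      also have "\<dots> = (\<Sum>i\<le>n. norm (poly (c i) z)) * norm (g z) ^ n"
        by (rule sum_distrib_right[symmetric])
      finally have "norm (poly (c (Suc n)) z) * norm (g z) * norm (g z) ^ n
          \<le> (\<Sum>i\<le>n. norm (poly (c i) z)) * norm (g z) ^ n"
        by (simp only: power_Suc mult.assoc)
      then have "norm (poly (c (Suc n)) z) * norm (g z) \<le> (\<Sum>i\<le>n. norm (poly (c i) z))"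
        by (rule mult_right_le_imp_le) (use False in \<open>intro zero_less_power, linarith\<close>)
      then have "a * norm (g z) \<le> (\<Sum>i\<le>n. norm (poly (c i) z))"
        using A(2)[OF z] by (meson mult_right_mono norm_ge_zero order_trans)
      then show ?thesis
        using A(1) by (simp add: B_def field_simps)
    qed
    have "poly_growth B" unfolding B_def by (intro poly_growth_intros)
    from entire_poly_growth_at_infinity[OF g this bound]
    obtain u where "\<And>z. g z = poly u z" by blast
    then have "g = poly u" by blast
    with ng show False using poly_growth_poly[of u] by simp
  qed
  moreover from this have "(\<Sum>i\<le>n. poly (c i) t * g t ^ i) = 0" for t
    using Suc.prems(2)[of t] by simp
  then have "c i = 0" if "i \<le> n" using Suc.IH[of i] that by blast
  ultimately show ?case using Suc.prems(1) le_Suc_eq by metis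
qed

text \<open>Outside a disc the factor \<open>S\<close> can be divided off, so exp(q) is a
  polynomial. It has no zeros, hence is constant by the fundamental theorem of algebra, and
  differentiating it gives q' = 0 without any choice of logarithm.\<close>

lemma poly_mult_exp_not_poly_growth:
  assumes S: "S \<noteq> 0" and gr: "poly_growth (\<lambda>t::complex. poly S t * exp (poly q t))"
  shows "degree q = 0"
proof -
  obtain A a where A: "a > 0" "\<And>z. norm z \<ge> A \<Longrightarrow> norm (poly S z) \<ge> a"
    using poly_eventually_ge[OF S] by blast
  have bound: "norm (exp (poly q z)) \<le> norm (poly S z * exp (poly q z)) * inverse a"
    if "norm z \<ge> A" for z
    using mult_right_mono[OF A(2)[OF that], of "norm (exp (poly q z))"] A(1)
    by (simp add: norm_mult field_simps)
  have gr': "poly_growth (\<lambda>z. norm (poly S z * exp (poly q z)) * inverse a)"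
    by (intro poly_growth_intros gr)
  have hol: "(\<lambda>z. exp (poly q z)) holomorphic_on UNIV"
    by (intro holomorphic_intros)
  obtain u where u: "\<And>z. exp (poly q z) = poly u z"
    using entire_poly_growth_at_infinity[OF hol gr' bound] by blast
  then have "poly u z \<noteq> 0" for z by (simp flip: u)
  then have "constant (poly u)" using fundamental_theorem_of_algebra by blast
  then have "poly u z = poly u 0" for z unfolding constant_def by blast
  then have "(\<lambda>z. exp (poly q z)) = (\<lambda>_. exp (poly q 0))"
    by (intro ext) (simp only: u)
  then have "((\<lambda>z. exp (poly q z)) has_field_derivative 0) (at z)" for z
    by (simp only: DERIV_const)
  moreover have "((\<lambda>z. exp (poly q z)) has_field_derivative
      exp (poly q z) * poly (pderiv q) z) (at z)" for z
    by (auto intro!: derivative_eq_intros)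
  ultimately have "exp (poly q z) * poly (pderiv q) z = 0" for z
    using DERIV_unique by blast
  then have "poly (pderiv q) z = 0" for z by simp
  then have "pderiv q = 0" using poly_all_0_iff_0 by blast
  then show ?thesis by (simp add: pderiv_eq_0_iff)
qed

section \<open>Monic relations with an exponential in one variable\<close>

text \<open>Every power below \<open>n\<close> is at most \<open>norm x ^ (n - 1)\<close>, and the
  coefficients together contribute at most \<open>norm x / 2\<close>. It is applied to both sides of
  the differentiated relation where \<open>g\<close> is large.\<close>

lemma lower_terms_le_half_power:
  fixes x :: complex
  assumes "1 \<le> norm x" "2 * (\<Sum>i<n. norm (a i)) \<le> norm x"
  shows "norm (\<Sum>i<n. a i * x ^ i) \<le> norm x ^ n / 2"
proof (cases n)
  case (Suc m)
  have "norm (\<Sum>i<n. a i * x ^ i) \<le> (\<Sum>i<n. norm (a i) * norm x ^ m)"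
    using assms(1) Suc
    by (intro sum_norm_le) (auto simp: norm_mult norm_power intro!: mult_left_mono power_increasing)
  also have "\<dots> = (\<Sum>i<n. norm (a i)) * norm x ^ m"
    by (rule sum_distrib_right[symmetric])
  also have "\<dots> \<le> (norm x / 2) * norm x ^ m"
    using assms(2) by (intro mult_right_mono) auto
  finally show ?thesis using Suc by simp
qed simp

text \<open>Cauchy's bound for the roots of a monic polynomial with constant term shifted by
  \<open>y\<close>: for \<open>norm x > 1\<close>, divide the equation by
  \<open>norm x ^ (n - 1)\<close>.\<close>

lemma monic_root_bound:
  fixes x :: complex
  assumes "x ^ n + (\<Sum>i<n. a i * x ^ i) = y" "n > 0"
  shows "norm x \<le> 1 + norm y + (\<Sum>i<n. norm (a i))"
proof (cases "norm x \<le> 1")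
  case True
  have "(\<Sum>i<n. norm (a i)) \<ge> 0" by (intro sum_nonneg) auto
  then show ?thesis using True norm_ge_zero[of y] by linarith
next
  case False
  obtain m where n: "n = Suc m" using assms(2) gr0_conv_Suc by blast
  have ge1: "1 \<le> norm x ^ m" using False by (intro one_le_power) auto
  have "norm x * norm x ^ m = norm (y - (\<Sum>i<n. a i * x ^ i))"
    using assms(1) n by (metis add_diff_cancel_right' norm_mult norm_power power_Suc)
  also have "\<dots> \<le> norm y + norm (\<Sum>i<n. a i * x ^ i)" by (rule norm_triangle_ineq4)
  also have "norm (\<Sum>i<n. a i * x ^ i) \<le> (\<Sum>i<n. norm (a i) * norm x ^ m)"
    using False n
    by (intro sum_norm_le) (auto simp: norm_mult norm_power intro!: mult_left_mono power_increasing)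
  also have "\<dots> = (\<Sum>i<n. norm (a i)) * norm x ^ m"
    by (rule sum_distrib_right[symmetric])
  also have "norm y \<le> norm y * norm x ^ m"
    using ge1 by (simp add: mult_le_cancel_left1)
  finally have "norm x * norm x ^ m \<le> (norm y + (\<Sum>i<n. norm (a i))) * norm x ^ m"
    by (simp add: distrib_right)
  then have "norm x \<le> norm y + (\<Sum>i<n. norm (a i))"
    by (rule mult_right_le_imp_le) (use ge1 in linarith)
  then show ?thesis by simp
qed

text \<open>Replacing 1 by 2 in the base absorbs the displacement. The result is a majorant at
  \<open>t\<close> that is valid on the whole unit ball around \<open>t\<close>, as needed for
  Cauchy's inequality on small circles.\<close>

lemma poly_growth_near:
  assumes "poly_growth F"
  obtains B :: "'a::real_normed_vector \<Rightarrow> real"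
  where "poly_growth B" "\<And>t. B t \<ge> 1" "\<And>s t. norm (s - t) \<le> 1 \<Longrightarrow> norm (F s) \<le> B t"
proof -
  obtain C N where C: "C \<ge> 1" "\<And>z. norm (F z) \<le> C * (1 + norm z) ^ N"
    using assms poly_growthE by blast
  show ?thesis
  proof (rule that[of "\<lambda>t. C * (2 + norm t) ^ N"])
    show "poly_growth (\<lambda>t::'a. C * (2 + norm t) ^ N)" by (intro poly_growth_intros)
    show "1 \<le> C * (2 + norm t) ^ N" for t :: 'a
      using C(1) one_le_power[of "2 + norm t" N] mult_mono[of 1 C 1 "(2 + norm t) ^ N"] by simp
    fix s t :: 'a assume st: "norm (s - t) \<le> 1"
    have "norm s \<le> norm (s - t) + norm t" using norm_triangle_ineq[of "s - t" t] by simp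
    then have "1 + norm s \<le> 2 + norm t" using st by simp
    then have "C * (1 + norm s) ^ N \<le> C * (2 + norm t) ^ N"
      using C(1) by (intro mult_left_mono power_mono) auto
    then show "norm (F s) \<le> C * (2 + norm t) ^ N" using C(2)[of s] by linarith
  qed
qed

text \<open>The derivative of the relation is \<open>E + A * g'\<close> on one side and
  \<open>poly \<tau> t * exp (poly q t)\<close> on the other. Multiplying by \<open>poly S t\<close>
  and inserting the relation again eliminates the exponential; collecting powers of
  \<open>g t\<close> leaves the coefficients \<open>\<beta>\<close>.\<close>

lemma log_derivative_identity:
  fixes g :: "complex \<Rightarrow> complex" and c :: "nat \<Rightarrow> complex poly"
  assumes g: "(g has_field_derivative g') (at t)"
    and eq: "\<And>t. (\<Sum>i\<le>Suc m. poly (c i) t * g t ^ i) = poly S t * exp (poly q t)"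
  defines "\<tau> \<equiv> pderiv S + S * pderiv q"
  defines "\<beta> \<equiv> \<lambda>i. of_nat (Suc m - i) * \<tau> * c i - of_nat (Suc m) * S * pderiv (c i)"
  shows "(\<Sum>i\<le>m. of_nat (Suc i) * poly (c (Suc i)) t * g t ^ i)
      * (of_nat (Suc m) * poly S t * g' - poly \<tau> t * g t)
    = (\<Sum>i\<le>Suc m. poly (\<beta> i) t * g t ^ i)"
proof -
  \<comment> \<open>\<open>A\<close> is the derivative of the relation in the variable
    \<open>w\<close>, \<open>E\<close> the contribution of its differentiated coefficients, and
    \<open>F\<close> the relation itself, all evaluated at \<open>g t\<close>.\<close>
  define A where "A = (\<Sum>i\<le>m. of_nat (Suc i) * poly (c (Suc i)) t * g t ^ i)"
  define E where "E = (\<Sum>i\<le>Suc m. poly (pderiv (c i)) t * g t ^ i)"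
  define F where "F = (\<Sum>i\<le>Suc m. poly (c i) t * g t ^ i)"
  have A: "A = (\<Sum>i\<le>Suc m. of_nat i * poly (c i) t * g t ^ (i - 1))"
    unfolding A_def by (subst sum.atMost_Suc_shift) simp
  \<comment> \<open>Multiplication by \<open>g t\<close> weights each term by its degree, as in
    Euler's identity; this is the source of the factor \<open>Suc m - i\<close> in
    \<open>\<beta>\<close>.\<close>
  have Ag: "A * g t = (\<Sum>i\<le>Suc m. of_nat i * poly (c i) t * g t ^ i)"
    unfolding A_def by (subst sum.atMost_Suc_shift) (simp add: sum_distrib_left mult_ac)
  have "((\<lambda>t. \<Sum>i\<le>Suc m. poly (c i) t * g t ^ i) has_field_derivative
      (\<Sum>i\<le>Suc m. poly (pderiv (c i)) t * g t ^ i + of_nat i * poly (c i) t * g t ^ (i - 1) * g')) (at t)"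
    by (rule DERIV_sum) (auto intro!: derivative_eq_intros g simp: mult_ac)
  then have dF: "((\<lambda>t. poly S t * exp (poly q t)) has_field_derivative E + A * g') (at t)"
    by (simp only: eq E_def A sum.distrib sum_distrib_right)
  have "((\<lambda>t. poly S t * exp (poly q t)) has_field_derivative poly \<tau> t * exp (poly q t)) (at t)"
    by (auto intro!: derivative_eq_intros simp: \<tau>_def algebra_simps)
  with dF have "E + A * g' = poly \<tau> t * exp (poly q t)" by (rule DERIV_unique)
  then have SF: "poly S t * (E + A * g') = poly \<tau> t * F"
    unfolding F_def eq by simp
  have "(\<Sum>i\<le>Suc m. poly (\<beta> i) t * g t ^ i)
     = (\<Sum>i\<le>Suc m. of_nat (Suc m) * poly \<tau> t * (poly (c i) t * g t ^ i)
          - poly \<tau> t * (of_nat i * poly (c i) t * g t ^ i)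
          - of_nat (Suc m) * poly S t * (poly (pderiv (c i)) t * g t ^ i))"
    by (intro sum.cong refl) (simp add: \<beta>_def of_nat_diff algebra_simps del: of_nat_Suc)
  also have "\<dots> = of_nat (Suc m) * poly \<tau> t * F - poly \<tau> t * (A * g t) - of_nat (Suc m) * poly S t * E"
    by (simp only: sum_subtractf F_def Ag E_def sum_distrib_left)
  also have "\<dots> = A * (of_nat (Suc m) * poly S t * g' - poly \<tau> t * g t)"
    using arg_cong[OF SF, of "\<lambda>x. of_nat (Suc m) * x"] by (simp only: algebra_simps)
  finally show ?thesis by (simp add: A_def)
qed


text \<open>The condition \<open>c m = 0\<close> is the Tschirnhaus normalisation. It rules out
  powers of a shifted variable, since (g + b)^(m+1) with b nonzero has a term of degree m.\<close>

theorem monic_relation_with_exponential: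
  fixes g :: "complex \<Rightarrow> complex" and c :: "nat \<Rightarrow> complex poly"
  assumes g: "g holomorphic_on UNIV"
    and eq: "\<And>t. (\<Sum>i\<le>Suc m. poly (c i) t * g t ^ i) = poly S t * exp (poly q t)"
    and top: "c (Suc m) = 1" "c m = 0"
    and S: "S \<noteq> 0" and q: "degree q > 0"
  shows "i \<le> m \<Longrightarrow> c i = 0"
proof -
  define \<tau> where "\<tau> = pderiv S + S * pderiv q"
  define \<beta> where "\<beta> = (\<lambda>i. of_nat (Suc m - i) * \<tau> * c i - of_nat (Suc m) * S * pderiv (c i))"
  define G where "G = (\<lambda>t. of_nat (Suc m) * poly S t * deriv g t - poly \<tau> t * g t)"
  \<comment> \<open>These are the coefficients of the partial derivative in \<open>w\<close>, so
    that \<open>key\<close> becomes the identity dT/dw(g) G = B(g).\<close>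
  define a where "a = (\<lambda>i. of_nat (Suc i) * c (Suc i))"
  have ng: "\<not> poly_growth g"
  proof
    assume "poly_growth g"
    then have "poly_growth (\<lambda>t. \<Sum>i\<le>Suc m. poly (c i) t * g t ^ i)"
      by (intro poly_growth_intros)
    then show False using poly_mult_exp_not_poly_growth[OF S] q by (simp only: eq)
  qed
  have dg: "(g has_field_derivative deriv g t) (at t)" for t
    using g by (simp add: holomorphic_derivI)
  have G: "G holomorphic_on UNIV"
    unfolding G_def by (intro holomorphic_intros g) auto
  \<comment> \<open>The normalisation takes effect here: \<open>\<beta> m\<close> vanishes with
    \<open>c m\<close>, and \<open>\<beta> (Suc m)\<close> because the relation is monic. The right
    side of \<open>key\<close> thus has degree below \<open>m\<close>, whereas the factor of
    \<open>G\<close> has degree \<open>m\<close>.\<close>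
  have \<beta>top: "\<beta> m = 0" "\<beta> (Suc m) = 0"
    by (simp_all add: \<beta>_def top)
  have key: "(\<Sum>i\<le>m. poly (a i) t * g t ^ i) * G t = (\<Sum>i<m. poly (\<beta> i) t * g t ^ i)" for t
  proof -
    have "(\<Sum>i\<le>m. poly (a i) t * g t ^ i) * G t = (\<Sum>i\<le>Suc m. poly (\<beta> i) t * g t ^ i)"
      using log_derivative_identity[OF dg eq] unfolding \<beta>_def \<tau>_def G_def a_def
      by (simp del: of_nat_Suc sum.atMost_Suc add: of_nat_poly)
    then show ?thesis by (simp add: \<beta>top lessThan_Suc_atMost[symmetric])
  qed
  \<comment> \<open>A single majorant \<open>B\<close> controls all the polynomials involved on the
    unit disc around \<open>t\<close>.\<close>
  have "poly_growth (\<lambda>t. norm (poly S t) + norm (poly (pderiv q) t) + norm (poly \<tau> t)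
      + (\<Sum>i\<le>m. norm (poly (c i) t)) + (\<Sum>i\<le>m. norm (poly (a i) t)) + (\<Sum>i<m. norm (poly (\<beta> i) t)))"
    (is "poly_growth ?F") by (intro poly_growth_intros)
  then obtain B where B: "poly_growth B" "\<And>t. B t \<ge> 1"
    "\<And>s t. norm (s - t) \<le> 1 \<Longrightarrow> norm (?F s) \<le> B t"
    using poly_growth_near by blast
  have bnd: "norm (poly S s) \<le> B t" "norm (poly (pderiv q) s) \<le> B t" "norm (poly \<tau> s) \<le> B t"
    "(\<Sum>i\<le>m. norm (poly (c i) s)) \<le> B t" "(\<Sum>i\<le>m. norm (poly (a i) s)) \<le> B t"
    "(\<Sum>i<m. norm (poly (\<beta> i) s)) \<le> B t" if "norm (s - t) \<le> 1" for s t
  proof -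
    have nn: "(\<Sum>i\<le>m. norm (poly (c i) s)) \<ge> 0" "(\<Sum>i\<le>m. norm (poly (a i) s)) \<ge> 0"
      "(\<Sum>i<m. norm (poly (\<beta> i) s)) \<ge> 0" by (auto intro: sum_nonneg)
    have "?F s \<le> B t" using B(3)[OF that] by (simp only: real_norm_def abs_le_iff)
    then show "norm (poly S s) \<le> B t" "norm (poly (pderiv q) s) \<le> B t" "norm (poly \<tau> s) \<le> B t"
      "(\<Sum>i\<le>m. norm (poly (c i) s)) \<le> B t" "(\<Sum>i\<le>m. norm (poly (a i) s)) \<le> B t"
      "(\<Sum>i<m. norm (poly (\<beta> i) s)) \<le> B t"
      using nn norm_ge_zero[of "poly S s"] norm_ge_zero[of "poly (pderiv q) s"]
        norm_ge_zero[of "poly \<tau> s"] by linarith+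
  qed
  obtain A \<sigma> where A: "\<sigma> > 0" "\<And>z. norm z \<ge> A \<Longrightarrow> norm (poly S z) \<ge> \<sigma>"
    using poly_eventually_ge[OF S] by blast
  \<comment> \<open>\<open>K\<close> separates large from small values of \<open>g\<close>, with the
    factor 2 of \<open>lower_terms_le_half_power\<close>. \<open>Y\<close> bounds S exp(q) on a
    small circle: the factors stand for \<open>S\<close>, the variation of \<open>q\<close>, the
    value of S exp(q) at the centre and the division by \<open>S\<close>. \<open>Z\<close> adds the
    Cauchy bound for the term with g' and the bound for the term with \<open>\<tau>\<close>.\<close>
  define K where "K = (\<lambda>t. 2 * B t)"
  define Y where "Y = (\<lambda>t. B t * (exp 1 * ((B t + 1) * K t ^ Suc m * inverse \<sigma>)))"
  define Z where "Z = (\<lambda>t. of_nat (Suc m) * B t * ((1 + Y t + B t) * B t) + B t * K t)"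
  have K1: "K t \<ge> 1" for t using B(2)[of t] by (simp add: K_def)
  have Y0: "Y t \<ge> 0" for t unfolding Y_def
    using B(2)[of t] K1[of t] A(1) by (intro mult_nonneg_nonneg) auto
  have Z1: "Z t \<ge> 1" for t
  proof -
    have "0 \<le> of_nat (Suc m) * B t * ((1 + Y t + B t) * B t)"
      using B(2)[of t] Y0[of t] by (intro mult_nonneg_nonneg) auto
    moreover have "1 * 1 \<le> B t * K t" using B(2)[of t] K1[of t] by (intro mult_mono) auto
    ultimately show ?thesis by (simp add: Z_def)
  qed

  \<comment> \<open>Polynomial bound for \<open>G\<close>, for large and for small values of
    \<open>g\<close>\<close>
  have bound: "norm (G t) \<le> Z t" if t: "norm t \<ge> A" for t
  proof (cases "norm (g t) \<ge> K t")
    case True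
    \<comment> \<open>Where \<open>g\<close> is large, dT/dw(g) has modulus at least half of
      \<open>norm (g t) ^ m\<close> and B(g) at most half of it, so the quotient \<open>G\<close>
      has modulus at most 1.\<close>
    have g1: "norm (g t) \<ge> 1" using True K1[of t] by simp
    have bt: "norm (\<Sum>i<m. poly (\<beta> i) t * g t ^ i) \<le> norm (g t) ^ m / 2"
      using bnd(6)[of t t] True g1 by (intro lower_terms_le_half_power) (auto simp: K_def)
    have "(\<Sum>i<m. norm (poly (a i) t)) \<le> (\<Sum>i\<le>m. norm (poly (a i) t))"
      by (intro sum_mono2) auto
    then have "norm (\<Sum>i<m. poly (a i) t * g t ^ i) \<le> norm (g t) ^ m / 2"
      using bnd(5)[of t t] True g1 by (intro lower_terms_le_half_power) (auto simp: K_def)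
    moreover have "norm (of_nat (Suc m) * g t ^ m) \<ge> norm (g t) ^ m"
      by (simp add: norm_mult norm_power mult_le_cancel_right1 del: of_nat_Suc)
    moreover have "(\<Sum>i\<le>m. poly (a i) t * g t ^ i)
        = of_nat (Suc m) * g t ^ m + (\<Sum>i<m. poly (a i) t * g t ^ i)"
      by (simp add: a_def top lessThan_Suc_atMost[symmetric] of_nat_poly)
    ultimately have "norm (\<Sum>i\<le>m. poly (a i) t * g t ^ i) \<ge> norm (g t) ^ m / 2"
      using norm_diff_ineq[of "of_nat (Suc m) * g t ^ m" "\<Sum>i<m. poly (a i) t * g t ^ i"]
      by simp
    then have "norm (g t) ^ m / 2 * norm (G t) \<le> norm (\<Sum>i<m. poly (\<beta> i) t * g t ^ i)"
      unfolding key[symmetric] norm_mult by (rule mult_right_mono) simp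
    also note bt
    finally have "norm (G t) * (norm (g t) ^ m / 2) \<le> 1 * (norm (g t) ^ m / 2)" by (simp add: mult.commute)
    then have "norm (G t) \<le> 1"
      by (rule mult_right_le_imp_le) (use g1 in \<open>intro divide_pos_pos zero_less_power, linarith+\<close>)
    then show ?thesis using Z1[of t] by linarith
  next
    case False
    \<comment> \<open>\<open>q\<close> varies by at most 1 on the disc of radius \<open>r\<close> around \<open>t\<close>.\<close>
    define r where "r = inverse (B t)"
    have r: "0 < r" "r \<le> 1" using B(2)[of t] by (auto simp: r_def inverse_le_1_iff)
    \<comment> \<open>At the centre \<open>t\<close> the relation turns the bound \<open>K t\<close>
      for \<open>g\<close> into a bound for S exp(q).\<close>
    have "norm (poly S t * exp (poly q t)) \<le> (B t + 1) * K t ^ Suc m"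
    proof -
      have "norm (poly S t * exp (poly q t)) \<le> (\<Sum>i\<le>Suc m. norm (poly (c i) t) * K t ^ Suc m)"
        unfolding eq[symmetric]
      proof (intro sum_norm_le)
        fix i assume i: "i \<in> {..Suc m}"
        have "norm (g t) ^ i \<le> K t ^ i" using False by (intro power_mono) auto
        also have "\<dots> \<le> K t ^ Suc m" using i K1 by (intro power_increasing) auto
        finally show "norm (poly (c i) t * g t ^ i) \<le> norm (poly (c i) t) * K t ^ Suc m"
          unfolding norm_mult norm_power by (intro mult_left_mono) auto
      qed
      also have "\<dots> = ((\<Sum>i\<le>m. norm (poly (c i) t)) + 1) * K t ^ Suc m"
        unfolding sum_distrib_right[symmetric] by (simp add: top)
      also have "\<dots> \<le> (B t + 1) * K t ^ Suc m"
        using bnd(4)[of t t] K1[of t] by (intro mult_right_mono) auto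
      finally show ?thesis .
    qed
    moreover have "\<sigma> * norm (exp (poly q t)) \<le> norm (poly S t * exp (poly q t))"
      unfolding norm_mult using A(2)[OF t] by (intro mult_right_mono) auto
    ultimately have "\<sigma> * norm (exp (poly q t)) \<le> (B t + 1) * K t ^ Suc m" by linarith
    then have expt: "norm (exp (poly q t)) \<le> (B t + 1) * K t ^ Suc m * inverse \<sigma>"
      using A(1) by (simp add: field_simps)
    \<comment> \<open>The bound for exp(q) is carried from \<open>t\<close> to the circle, and there
      the relation, read as a monic equation for \<open>g s\<close>, bounds \<open>g s\<close> in
      turn.\<close>
    have gs: "norm (g s) \<le> 1 + Y t + B t" if s: "norm (t - s) = r" for s
    proof -
      have st: "norm (s - t) = r" using s by (simp add: norm_minus_commute)
      have "norm (poly q s - poly q t) \<le> B t * norm (s - t)"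
      proof (rule field_differentiable_bound[of "cball t r"])
        show "(poly q has_field_derivative poly (pderiv q) z) (at z within cball t r)" for z
          by (rule poly_DERIV[THEN has_field_derivative_at_within])
        show "norm (poly (pderiv q) z) \<le> B t" if "z \<in> cball t r" for z
          using that r by (intro bnd) (auto simp: dist_norm norm_minus_commute)
      qed (use r st in \<open>auto simp: dist_norm norm_minus_commute\<close>)
      also have "\<dots> = 1" using B(2)[of t] by (simp add: st r_def)
      finally have "Re (poly q s) \<le> 1 + Re (poly q t)"
        using complex_Re_le_cmod[of "poly q s - poly q t"] by simp
      then have "norm (exp (poly q s)) \<le> exp 1 * norm (exp (poly q t))"
        by (simp flip: exp_add)
      also have "\<dots> \<le> exp 1 * ((B t + 1) * K t ^ Suc m * inverse \<sigma>)"
        using expt by (intro mult_left_mono) auto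
      finally have "norm (poly S s * exp (poly q s)) \<le> Y t"
        unfolding Y_def norm_mult using bnd(1)[of s t] st r B(2)[of t] by (intro mult_mono) auto
      moreover have "norm (g s) \<le> 1 + norm (poly S s * exp (poly q s)) + (\<Sum>i<Suc m. norm (poly (c i) s))"
      proof (rule monic_root_bound)
        show "g s ^ Suc m + (\<Sum>i<Suc m. poly (c i) s * g s ^ i) = poly S s * exp (poly q s)"
          unfolding eq[symmetric] lessThan_Suc_atMost by (simp add: top)
      qed simp
      moreover have "(\<Sum>i<Suc m. norm (poly (c i) s)) \<le> B t"
        unfolding lessThan_Suc_atMost using st r by (intro bnd) simp
      ultimately show ?thesis by linarith
    qed
    have "norm ((deriv ^^ 1) g t) \<le> fact 1 * (1 + Y t + B t) / r ^ 1"
      by (rule Cauchy_inequality)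
        (use g r gs in \<open>auto intro: holomorphic_on_subset holomorphic_on_imp_continuous_on\<close>)
    then have "norm (deriv g t) \<le> (1 + Y t + B t) * B t" by (simp add: r_def divide_inverse)
    then have "norm (of_nat (Suc m) * poly S t * deriv g t)
        \<le> of_nat (Suc m) * B t * ((1 + Y t + B t) * B t)"
      unfolding norm_mult norm_of_nat using bnd(1)[of t t] B(2)[of t] by (intro mult_mono) auto
    moreover have "norm (poly \<tau> t * g t) \<le> B t * K t"
      unfolding norm_mult using bnd(3)[of t t] B(2)[of t] False by (intro mult_mono) auto
    ultimately show ?thesis
      unfolding G_def Z_def by (intro order_trans[OF norm_triangle_ineq4] add_mono)
  qed

  \<comment> \<open>Vanishing of \<open>G\<close> and of the coefficients
    \<open>\<beta>\<close>\<close>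
  have "poly_growth Z" unfolding Z_def Y_def K_def by (intro poly_growth_intros B(1))
  from entire_poly_growth_at_infinity[OF G this bound]
  obtain u where u: "\<And>t. G t = poly u t" by blast
  \<comment> \<open>With \<open>G\<close> replaced by the polynomial \<open>u\<close>,
    \<open>key\<close> is an algebraic relation for \<open>g\<close> with coefficients
    \<open>d i\<close>.\<close>
  define d where "d = (\<lambda>i. a i * u - \<beta> i)"
  have "(\<Sum>i\<le>m. poly (d i) t * g t ^ i) = 0" for t
  proof -
    have "(\<Sum>i\<le>m. poly (d i) t * g t ^ i)
        = (\<Sum>i\<le>m. poly (a i) t * g t ^ i * G t - poly (\<beta> i) t * g t ^ i)"
      by (intro sum.cong refl) (simp add: d_def u algebra_simps)
    also have "\<dots> = (\<Sum>i\<le>m. poly (a i) t * g t ^ i) * G t - (\<Sum>i\<le>m. poly (\<beta> i) t * g t ^ i)"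
      by (simp only: sum_subtractf sum_distrib_right)
    finally show ?thesis
      unfolding key by (simp add: \<beta>top lessThan_Suc_atMost[symmetric])
  qed
  then have d0: "d i = 0" if "i \<le> m" for i
    using algebraic_entire_imp_polynomial[OF g ng] that by blast
  \<comment> \<open>At index \<open>m\<close> only the constant multiple
    \<open>of_nat (Suc m) * u\<close> remains, because \<open>\<beta> m = 0\<close> and
    \<open>c (Suc m) = 1\<close>.\<close>
  have "u = 0"
    using d0[of m] by (simp add: d_def \<beta>top a_def top del: of_nat_Suc)
  then have \<beta>0: "\<beta> i = 0" if "i \<le> m" for i
    using d0[OF that] by (simp add: d_def)

  \<comment> \<open>Comparison of degrees in the equation for \<open>c i\<close>\<close>
  show "c i = 0" if i: "i \<le> m"
  proof (rule ccontr)
    assume nz: "c i \<noteq> 0"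
    have pq: "pderiv q \<noteq> 0" using q by (simp add: pderiv_eq_0_iff)
    have dS: "degree (S * pderiv q) \<ge> degree S" using pq S by (simp add: degree_mult_eq)
    \<comment> \<open>The term \<open>S * pderiv q\<close> has degree at least that of
      \<open>S\<close> and \<open>pderiv S\<close> is zero or of smaller degree, so no cancellation
      can occur. A nonzero \<open>c i\<close>, by contrast, loses degree on differentiation.\<close>
    have \<tau>: "\<tau> \<noteq> 0 \<and> degree \<tau> \<ge> degree S"
    proof (cases "degree S = 0")
      case True
      then show ?thesis using S pq by (simp add: \<tau>_def pderiv_eq_0_iff[THEN iffD2])
    next
      case False
      then have "degree (pderiv S) < degree (S * pderiv q)"
        using dS by (simp add: degree_pderiv)
      then have "degree \<tau> = degree (S * pderiv q)"
        unfolding \<tau>_def by (rule degree_add_eq_right)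
      then show ?thesis using dS False by auto
    qed
    define k :: "complex poly" where "k = of_nat (Suc m - i)"
    have e: "k * \<tau> * c i = of_nat (Suc m) * S * pderiv (c i)"
      using \<beta>0[OF i] by (simp add: \<beta>_def k_def)
    have k: "k \<noteq> 0" "degree k = 0"
      using i by (simp_all add: k_def del: of_nat_Suc of_nat_diff)
    then have nz': "k * \<tau> * c i \<noteq> 0" using \<tau> nz by simp
    with e have pc: "pderiv (c i) \<noteq> 0" by auto
    have "degree (k * \<tau> * c i) = degree \<tau> + degree (c i)"
      using k \<tau> nz by (simp add: degree_mult_eq)
    moreover have "degree (of_nat (Suc m) * S * pderiv (c i)) = degree S + degree (pderiv (c i))"
      using pc S by (simp add: degree_mult_eq del: of_nat_Suc)
    moreover have "degree (pderiv (c i)) < degree (c i)"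
      using pc by (auto simp: degree_pderiv pderiv_eq_0_iff)
    ultimately show False using e \<tau> by simp
  qed
qed

section \<open>Polynomials on \<open>\<complex>\<^sup>n\<close>\<close>

lemma poly_deg_le_mono:
  fixes f :: "complex ^ 'n \<Rightarrow> complex"
  assumes "poly_deg_le d f" "d \<le> e"
  shows "poly_deg_le e f"
proof -
  obtain c where c: "\<And>z. f z = (\<Sum>\<alpha>\<in>multi_indices d. c \<alpha> * (\<Prod>i\<in>UNIV. (z $ i) ^ \<alpha> i))"
    using assms(1) unfolding poly_deg_le_def by blast
  have "(\<Sum>\<alpha>\<in>multi_indices d. c \<alpha> * (\<Prod>i\<in>UNIV. (z $ i) ^ \<alpha> i))
      = (\<Sum>\<alpha>\<in>multi_indices e. (if \<alpha> \<in> multi_indices d then c \<alpha> else 0) * (\<Prod>i\<in>UNIV. (z $ i) ^ \<alpha> i))" for z :: "complex ^ 'n"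
    by (rule sum.mono_neutral_cong_left[OF finite_multi_indices])
       (use assms(2) in \<open>auto simp: multi_indices_def\<close>)
  then show ?thesis unfolding poly_deg_le_def c
    by (intro exI[of _ "\<lambda>\<alpha>. if \<alpha> \<in> multi_indices d then c \<alpha> else 0"]) blast
qed

lemma polynomial_fun_add:
  fixes f g :: "complex ^ 'n \<Rightarrow> complex"
  assumes "polynomial_fun f" "polynomial_fun g"
  shows "polynomial_fun (\<lambda>z. f z + g z)"
proof -
  obtain d e where "poly_deg_le d f" "poly_deg_le e g"
    using assms unfolding polynomial_fun_def by blast
  then have "poly_deg_le (d + e) f" "poly_deg_le (d + e) g"
    by (auto elim: poly_deg_le_mono)
  then obtain a b where "\<And>z. f z = (\<Sum>\<alpha>\<in>multi_indices (d + e). a \<alpha> * (\<Prod>i\<in>UNIV. (z $ i) ^ \<alpha> i))"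
    "\<And>z. g z = (\<Sum>\<alpha>\<in>multi_indices (d + e). b \<alpha> * (\<Prod>i\<in>UNIV. (z $ i) ^ \<alpha> i))"
    unfolding poly_deg_le_def by blast
  then have "poly_deg_le (d + e) (\<lambda>z. f z + g z)"
    unfolding poly_deg_le_def
    by (intro exI[of _ "\<lambda>\<alpha>. a \<alpha> + b \<alpha>"]) (simp add: distrib_right sum.distrib)
  then show ?thesis unfolding polynomial_fun_def by blast
qed

lemma polynomial_fun_monomial: "polynomial_fun (\<lambda>z::complex ^ 'n. c * (\<Prod>i\<in>UNIV. (z $ i) ^ \<alpha> i))"
proof -
  have "c * (\<Prod>i\<in>UNIV. (z $ i) ^ \<alpha> i)
      = (\<Sum>\<beta>\<in>multi_indices (\<Sum>i\<in>UNIV. \<alpha> i). (if \<beta> = \<alpha> then c else 0) * (\<Prod>i\<in>UNIV. (z $ i) ^ \<beta> i))" for z :: "complex ^ 'n"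
    by (simp add: if_distrib[of "\<lambda>x. x * _"] finite_multi_indices cong: if_cong)
       (simp add: multi_indices_def)
  then show ?thesis unfolding polynomial_fun_def poly_deg_le_def
    by (intro exI[of _ "\<Sum>i\<in>UNIV. \<alpha> i"] exI[of _ "\<lambda>\<beta>. if \<beta> = \<alpha> then c else 0"]) blast
qed

lemma polynomial_fun_const: "polynomial_fun (\<lambda>_. c)"
  using polynomial_fun_monomial[of c "\<lambda>_. 0"] by simp

lemma polynomial_fun_sum:
  "(\<And>i. i \<in> A \<Longrightarrow> polynomial_fun (f i)) \<Longrightarrow> polynomial_fun (\<lambda>z. \<Sum>i\<in>A. f i z)"
  by (induction A rule: infinite_finite_induct) (auto intro: polynomial_fun_add polynomial_fun_const)

lemma polynomial_funE:
  fixes f :: "complex ^ 'n \<Rightarrow> complex"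
  assumes "polynomial_fun f"
  obtains d c where "\<And>z. f z = (\<Sum>\<alpha>\<in>multi_indices d. c \<alpha> * (\<Prod>i\<in>UNIV. (z $ i) ^ \<alpha> i))"
  using assms unfolding polynomial_fun_def poly_deg_le_def by blast

lemma polynomial_fun_mult:
  fixes f g :: "complex ^ 'n \<Rightarrow> complex"
  assumes "polynomial_fun f" "polynomial_fun g"
  shows "polynomial_fun (\<lambda>z. f z * g z)"
proof -
  obtain d a where f: "\<And>z. f z = (\<Sum>\<alpha>\<in>multi_indices d. a \<alpha> * (\<Prod>i\<in>UNIV. (z $ i) ^ \<alpha> i))"
    using assms(1) polynomial_funE by blast
  obtain e b where g: "\<And>z. g z = (\<Sum>\<alpha>\<in>multi_indices e. b \<alpha> * (\<Prod>i\<in>UNIV. (z $ i) ^ \<alpha> i))"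
    using assms(2) polynomial_funE by blast
  have "f z * g z = (\<Sum>\<alpha>\<in>multi_indices d. \<Sum>\<beta>\<in>multi_indices e.
      (a \<alpha> * b \<beta>) * (\<Prod>i\<in>UNIV. (z $ i) ^ (\<alpha> i + \<beta> i)))" for z
    unfolding f g sum_product by (simp add: power_add prod.distrib mult_ac)
  moreover have "polynomial_fun (\<lambda>z. \<Sum>\<alpha>\<in>multi_indices d. \<Sum>\<beta>\<in>multi_indices e.
      (a \<alpha> * b \<beta>) * (\<Prod>i\<in>UNIV. (z $ i) ^ (\<alpha> i + \<beta> i)))"
    by (intro polynomial_fun_sum polynomial_fun_monomial[of _ "\<lambda>i. _ i + _ i"])
  ultimately show ?thesis by (simp only:)
qed

lemma polynomial_fun_power: "polynomial_fun f \<Longrightarrow> polynomial_fun (\<lambda>z. f z ^ k)"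
  by (induction k) (auto intro: polynomial_fun_mult polynomial_fun_const)

lemma polynomial_fun_component: "polynomial_fun (\<lambda>z::complex ^ 'n. z $ i)"
proof -
  define \<alpha> where "\<alpha> = (\<lambda>j. if j = i then 1 else 0 :: nat)"
  have "(z $ j) ^ \<alpha> j = (if j = i then z $ j else 1)" for z :: "complex ^ 'n" and j
    by (simp add: \<alpha>_def)
  then have eq: "1 * (\<Prod>j\<in>UNIV. (z $ j) ^ \<alpha> j) = z $ i" for z :: "complex ^ 'n"
    by simp
  have "polynomial_fun (\<lambda>z::complex ^ 'n. 1 * (\<Prod>j\<in>UNIV. (z $ j) ^ \<alpha> j))"
    by (rule polynomial_fun_monomial)
  then show ?thesis unfolding eq .
qed

lemma poly_growth_polynomial_fun:
  fixes f :: "complex ^ 'n \<Rightarrow> complex"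
  assumes "polynomial_fun f" shows "poly_growth f"
proof -
  obtain d c where "\<And>z. f z = (\<Sum>\<alpha>\<in>multi_indices d. c \<alpha> * (\<Prod>i\<in>UNIV. (z $ i) ^ \<alpha> i))"
    using assms polynomial_funE by blast
  then have f: "f = (\<lambda>z. \<Sum>\<alpha>\<in>multi_indices d. c \<alpha> * (\<Prod>i\<in>UNIV. (z $ i) ^ \<alpha> i))" by (rule ext)
  have "poly_growth (\<lambda>z::complex ^ 'n. z $ i)" for i
    by (rule poly_growth_mono[OF poly_growth_norm_arg]) (simp add: Finite_Cartesian_Product.norm_nth_le)
  then show ?thesis unfolding f by (intro poly_growth_intros)
qed

section \<open>Restriction of polynomials to complex lines\<close>

lemma coeff_mult_at_sum:
  assumes "degree p \<le> m" "degree q \<le> n"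
  shows "coeff (p * q) (m + n) = coeff p m * coeff q n"
proof (cases "degree p = m \<and> degree q = n")
  case True
  then show ?thesis using coeff_mult_degree_sum[of p q] by simp
next
  case False
  then have "degree p < m \<or> degree q < n" using assms by auto
  moreover from this have "degree (p * q) < m + n"
    using degree_mult_le[of p q] assms by linarith
  ultimately show ?thesis by (auto simp: coeff_eq_0)
qed

text \<open>The \<open>n i\<close> are mere upper bounds for the degrees: where one of them is not
  attained, both sides of the coefficient identity vanish.\<close>

lemma coeff_prod_at_sum:
  assumes "finite A" "\<And>i. i \<in> A \<Longrightarrow> degree (f i) \<le> n i"
  shows "degree (\<Prod>i\<in>A. f i) \<le> (\<Sum>i\<in>A. n i) \<and>
    coeff (\<Prod>i\<in>A. f i) (\<Sum>i\<in>A. n i) = (\<Prod>i\<in>A. coeff (f i) (n i))"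
  using assms
proof (induction A rule: finite_induct)
  case (insert a A)
  then have IH: "degree (f a) \<le> n a" "degree (\<Prod>i\<in>A. f i) \<le> (\<Sum>i\<in>A. n i)"
    "coeff (\<Prod>i\<in>A. f i) (\<Sum>i\<in>A. n i) = (\<Prod>i\<in>A. coeff (f i) (n i))" by auto
  then have "degree (f a * (\<Prod>i\<in>A. f i)) \<le> n a + (\<Sum>i\<in>A. n i)"
    using degree_mult_le[of "f a" "\<Prod>i\<in>A. f i"] by linarith
  then show ?case using insert.hyps IH by (simp add: coeff_mult_at_sum)
qed simp

text \<open>A monomial becomes a product of linear factors in \<open>t\<close>, whose top
  coefficient involves only the direction \<open>v\<close>. The coefficient of degree
  \<open>d\<close> is therefore the top homogeneous part at \<open>v\<close>, whatever the base
  point \<open>z\<close>.\<close>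

lemma polynomial_fun_on_line:
  fixes q :: "complex ^ 'n \<Rightarrow> complex" and z v :: "complex ^ 'n"
  assumes "\<And>z. q z = (\<Sum>\<alpha>\<in>multi_indices d. c \<alpha> * (\<Prod>i\<in>UNIV. (z $ i) ^ \<alpha> i))"
  obtains u where "degree u \<le> d" "\<And>t. q (z + t *s v) = poly u t"
    "coeff u d = (\<Sum>\<alpha> | sum \<alpha> UNIV = d. c \<alpha> * (\<Prod>i\<in>UNIV. (v $ i) ^ \<alpha> i))"
proof -
  define w where "w = (\<lambda>\<alpha>::'n \<Rightarrow> nat. \<Prod>i\<in>UNIV. [:z $ i, v $ i:] ^ \<alpha> i)"
  define u where "u = (\<Sum>\<alpha>\<in>multi_indices d. smult (c \<alpha>) (w \<alpha>))"
  have dl: "degree ([:a, b:] ^ n) \<le> n" for a b :: complex and n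
    by (rule order_trans[OF degree_power_le]) simp
  have w: "degree (w \<alpha>) \<le> sum \<alpha> UNIV" "coeff (w \<alpha>) (sum \<alpha> UNIV) = (\<Prod>i\<in>UNIV. (v $ i) ^ \<alpha> i)" for \<alpha>
    using coeff_prod_at_sum[of UNIV "\<lambda>i. [:z $ i, v $ i:] ^ \<alpha> i" \<alpha>] dl
    by (auto simp: w_def coeff_linear_poly_power)
  show ?thesis
  proof (rule that[of u])
    show "degree u \<le> d" unfolding u_def
      by (intro degree_sum_le finite_multi_indices order_trans[OF degree_smult_le])
         (auto simp: multi_indices_def intro: order_trans[OF w(1)])
    show "q (z + t *s v) = poly u t" for t
      by (simp add: assms u_def w_def poly_sum poly_prod poly_power mult.commute)
    have "coeff u d = (\<Sum>\<alpha>\<in>multi_indices d. c \<alpha> * coeff (w \<alpha>) d)"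
      by (simp add: u_def coeff_sum)
    also have "\<dots> = (\<Sum>\<alpha> | sum \<alpha> UNIV = d. c \<alpha> * (\<Prod>i\<in>UNIV. (v $ i) ^ \<alpha> i))"
    proof (rule sum.mono_neutral_cong_right[OF finite_multi_indices])
      show "\<forall>\<alpha>\<in>multi_indices d - {\<alpha>. sum \<alpha> UNIV = d}. c \<alpha> * coeff (w \<alpha>) d = 0"
      proof
        fix \<alpha> :: "'n \<Rightarrow> nat" assume "\<alpha> \<in> multi_indices d - {\<alpha>. sum \<alpha> UNIV = d}"
        then have "degree (w \<alpha>) < d"
          using w(1)[of \<alpha>] by (simp add: multi_indices_def)
        then show "c \<alpha> * coeff (w \<alpha>) d = 0" by (simp add: coeff_eq_0)
      qed
    qed (use w(2) in \<open>auto simp: multi_indices_def\<close>)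
    finally show "coeff u d = (\<Sum>\<alpha> | sum \<alpha> UNIV = d. c \<alpha> * (\<Prod>i\<in>UNIV. (v $ i) ^ \<alpha> i))" .
  qed
qed

text \<open>For minimal \<open>d\<close> the homogeneous part of degree \<open>d\<close> is not
  identically zero, as otherwise \<open>d\<close> could be lowered or \<open>q\<close> would be
  zero. Any \<open>v\<close> where it does not vanish gives all lines parallel to \<open>v\<close>
  the same nonzero leading coefficient.\<close>

lemma polynomial_fun_regular_direction:
  fixes q :: "complex ^ 'n \<Rightarrow> complex"
  assumes "polynomial_fun q" "q \<noteq> (\<lambda>_. 0)"
  obtains a v where "a \<noteq> 0" "\<forall>z. \<exists>u. lead_coeff u = a \<and> (\<forall>t. q (z + t *s v) = poly u t)"
proof -
  define d where "d = (LEAST d. poly_deg_le d q)"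
  have "poly_deg_le d q"
    unfolding d_def using assms(1) LeastI_ex unfolding polynomial_fun_def by metis
  then obtain c where c: "\<And>z. q z = (\<Sum>\<alpha>\<in>multi_indices d. c \<alpha> * (\<Prod>i\<in>UNIV. (z $ i) ^ \<alpha> i))"
    unfolding poly_deg_le_def by blast
  define h where "h = (\<lambda>v::complex ^ 'n. \<Sum>\<alpha> | sum \<alpha> UNIV = d. c \<alpha> * (\<Prod>i\<in>UNIV. (v $ i) ^ \<alpha> i))"
  have "\<exists>v. h v \<noteq> 0"
  proof (rule ccontr)
    assume "\<not> ?thesis"
    then have h0: "h v = 0" for v by blast
    have split: "q z = h z + (\<Sum>\<alpha> | sum \<alpha> UNIV < d. c \<alpha> * (\<Prod>i\<in>UNIV. (z $ i) ^ \<alpha> i))" for z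
    proof -
      have "multi_indices d = {\<alpha>::'n \<Rightarrow> nat. sum \<alpha> UNIV = d} \<union> {\<alpha>. sum \<alpha> UNIV < d}"
        by (auto simp: multi_indices_def)
      moreover from this have "finite {\<alpha>::'n \<Rightarrow> nat. sum \<alpha> UNIV = d}" "finite {\<alpha>::'n \<Rightarrow> nat. sum \<alpha> UNIV < d}"
        using finite_multi_indices[of d] by (metis finite_Un)+
      ultimately show ?thesis unfolding c h_def by (subst sum.union_disjoint[symmetric]) auto
    qed
    show False
    proof (cases d)
      case 0
      then show False using split h0 assms(2) by auto
    next
      case (Suc e)
      then have "{\<alpha>::'n \<Rightarrow> nat. sum \<alpha> UNIV < d} = multi_indices e"
        by (auto simp: multi_indices_def)
      then have "poly_deg_le e q"
        unfolding poly_deg_le_def using split h0 by (intro exI[of _ c]) simp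
      then have "d \<le> e" unfolding d_def by (rule Least_le)
      then show False using Suc by simp
    qed
  qed
  then obtain v where v: "h v \<noteq> 0" by blast
  show ?thesis
  proof (rule that[OF v], rule allI)
    fix z
    obtain u where u: "degree u \<le> d" "\<And>t. q (z + t *s v) = poly u t" "coeff u d = h v"
      using polynomial_fun_on_line[OF c, of z v] unfolding h_def by blast
    have "degree u = d" using u(1,3) v by (metis le_degree le_antisym)
    then show "\<exists>u. lead_coeff u = h v \<and> (\<forall>t. q (z + t *s v) = poly u t)"
      using u by blast
  qed
qed

text \<open>On the unit circle \<open>u\<close> has the same modulus as its reflected conjugate, whose value at the
  origin is the conjugate of the leading coefficient of \<open>u\<close>; now apply the maximum principle.\<close>

lemma lead_coeff_mult_le_on_circle:
  assumes h: "h holomorphic_on UNIV"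
  obtains t where "norm t = 1" "norm (lead_coeff u * h 0) \<le> norm (poly u t * h t)"
proof -
  define \<phi> where "\<phi> = (\<lambda>t. poly (reflect_poly (map_poly cnj u)) t * h t)"
  have \<phi>: "\<phi> holomorphic_on UNIV" unfolding \<phi>_def by (intro holomorphic_intros h)
  have lc: "lead_coeff (map_poly cnj u) = cnj (lead_coeff u)"
    by (simp add: degree_map_poly coeff_map_poly)
  have eq: "norm (\<phi> t) = norm (poly u t * h t)" if "norm t = 1" for t
  proof -
    have "t * cnj t = 1" using complex_norm_square[of t] that by simp
    then have "inverse t = cnj t" by (rule inverse_unique)
    moreover have "t \<noteq> 0" using that by auto
    ultimately show ?thesis using that
      by (simp add: \<phi>_def norm_mult norm_power poly_reflect_poly_nz)
  qed
  have "continuous_on (sphere 0 1) (\<lambda>t. norm (\<phi> t))"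
    by (intro continuous_on_norm continuous_on_subset[OF holomorphic_on_imp_continuous_on[OF \<phi>]]) auto
  then obtain t where t: "t \<in> sphere 0 1" "\<And>s. s \<in> sphere 0 1 \<Longrightarrow> norm (\<phi> s) \<le> norm (\<phi> t)"
    using continuous_attains_sup[of "sphere (0::complex) 1" "\<lambda>t. norm (\<phi> t)"] by auto
  have "norm (\<phi> 0) \<le> norm (\<phi> t)"
    by (rule maximum_modulus_frontier[of \<phi> "ball 0 1"])
       (use t(2) \<phi> in \<open>auto intro: holomorphic_on_subset holomorphic_on_imp_continuous_on\<close>)
  moreover have "norm (\<phi> 0) = norm (lead_coeff u * h 0)"
    by (simp add: \<phi>_def norm_mult lc)
  ultimately show ?thesis using that[of t] t(1) eq[of t] by simp
qed

text \<open>Along a regular direction \<open>v\<close> of \<open>q\<close>, the circle estimate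
  applies on the line through \<open>z\<close>. The leading coefficient is the same on all these
  lines, so \<open>C\<close> and \<open>r\<close> depend neither on \<open>h\<close> nor on
  \<open>z\<close>.\<close>

lemma entire_le_polynomial_multiple:
  fixes q :: "complex ^ 'n \<Rightarrow> complex"
  assumes "polynomial_fun q" "q \<noteq> (\<lambda>_. 0)"
  obtains C r where "C \<ge> 0"
    "\<And>h z. entire h \<Longrightarrow> \<exists>w. norm (w - z) \<le> r \<and> norm (h z) \<le> C * norm (q w * h w)"
proof -
  obtain a v where a: "a \<noteq> 0" and
    u: "\<forall>z. \<exists>u. lead_coeff u = a \<and> (\<forall>t. q (z + t *s v) = poly u t)"
    using polynomial_fun_regular_direction[OF assms] by blast
  show ?thesis
  proof (rule that[of "inverse (norm a)" "norm v"])
    fix h :: "complex ^ 'n \<Rightarrow> complex" and z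
    assume "entire h"
    then have hol: "(\<lambda>t. h (z + t *s v)) holomorphic_on UNIV" by (rule entire_on_line)
    from u obtain u where u: "lead_coeff u = a" "\<And>t. q (z + t *s v) = poly u t"
      by blast
    obtain t where t: "norm t = 1"
      "norm (lead_coeff u * h (z + 0 *s v)) \<le> norm (poly u t * h (z + t *s v))"
      by (rule lead_coeff_mult_le_on_circle[OF hol, of u])
    have "norm (t *s v) = norm v"
      using t(1) by (simp add: norm_vec_def norm_mult)
    moreover have "norm (h z) \<le> inverse (norm a) * norm (q (z + t *s v) * h (z + t *s v))"
      using t(2) a by (simp add: u norm_mult field_simps)
    ultimately show "\<exists>w. norm (w - z) \<le> norm v \<and> norm (h z) \<le> inverse (norm a) * norm (q w * h w)"
      by (intro exI[of _ "z + t *s v"]) auto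
  qed simp
qed

section \<open>Growth and polynomiality on \<open>\<complex>\<^sup>n\<close>\<close>

text \<open>The map x -> x / (2M - x) fixes 0 and sends the half plane Re x < M into the unit disc.
  Schwarz's lemma for its composition with the rescaled \<open>F\<close> gives |F| <= |2M - F| / 2
  at half the radius, hence |F| <= 2M.\<close>

lemma Borel_Caratheodory_half_radius:
  assumes F: "F holomorphic_on UNIV" "F 0 = 0"
    and R: "R > 0" and Re: "\<And>z. norm z < R \<Longrightarrow> Re (F z) < M"
    and z: "norm z \<le> R / 2"
  shows "norm (F z) \<le> 2 * M"
proof -
  have M: "M > 0" using Re[of 0] F R by simp
  have lt: "norm (F w) < norm (2 * of_real M - F w)" if "norm w < R" for w
  proof -
    \<comment> \<open>The squares of the two moduli to be compared differ by four times this
      product.\<close>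
    have "0 < M * (M - Re (F w))" using M Re[OF that] by (intro mult_pos_pos) auto
    then have "(norm (F w))\<^sup>2 < (norm (2 * of_real M - F w))\<^sup>2"
      unfolding cmod_power2 by (simp add: power2_eq_square algebra_simps)
    then show ?thesis by (rule power2_less_imp_less) simp
  qed
  define \<phi> where "\<phi> = (\<lambda>w. F (of_real R * w) / (2 * of_real M - F (of_real R * w)))"
  have scale: "norm (of_real R * w) < R" if "norm w < 1" for w :: complex
    using that R by (simp add: norm_mult)
  have nz: "2 * of_real M - F (of_real R * w) \<noteq> 0" if "norm w < 1" for w :: complex
    using lt[OF scale[OF that]] norm_ge_zero[of "F (of_real R * w)"] by force
  have hol: "(\<lambda>w. F (of_real R * w)) holomorphic_on ball 0 1"
    using holomorphic_on_compose[of "\<lambda>w. of_real R * w" "ball 0 1" F]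
      holomorphic_on_subset[OF F(1)] by (auto simp: o_def intro!: holomorphic_intros)
  define w where "w = z / of_real R"
  have w: "norm w \<le> 1 / 2" "of_real R * w = z"
    using z R by (auto simp: w_def norm_divide field_simps)
  have "norm (\<phi> w) \<le> norm w"
  proof (rule Schwarz_Lemma(1))
    show "\<phi> holomorphic_on ball 0 1"
      unfolding \<phi>_def using nz by (intro holomorphic_intros hol) auto
    show "\<phi> 0 = 0" by (simp add: \<phi>_def F)
    show "norm (\<phi> x) < 1" if "norm x < 1" for x
      using lt[OF scale[OF that]] norm_ge_zero[of "F (of_real R * x)"]
      unfolding \<phi>_def norm_divide by (subst divide_less_eq_1_pos) auto
  qed (use w in auto)
  then have "norm (\<phi> w) \<le> 1 / 2" using w by linarith
  then have "norm (F z) \<le> norm (2 * of_real M - F z) / 2"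
    unfolding \<phi>_def w norm_divide using nz[of w] w by (simp add: field_simps)
  also have "norm (2 * of_real M - F z) \<le> 2 * M + norm (F z)"
    using norm_triangle_ineq4[of "2 * of_real M" "F z"] M by (simp add: norm_mult)
  finally show ?thesis by simp
qed

text \<open>The Borel-Caratheodory inequality on the disc of radius \<open>2 * norm t\<close> bounds
  the modulus, and Liouville's theorem applies. The degree bound \<open>N\<close> is kept because
  the passage to several variables needs it uniformly on all coordinate lines.\<close>

lemma entire_Re_bounded_imp_polynomial:
  assumes F: "F holomorphic_on UNIV" and Re: "\<And>t. Re (F t) \<le> C * (1 + norm t) ^ N"
  obtains u where "degree u \<le> N" "\<And>t. F t = poly u t"
proof -
  \<comment> \<open>The three summands make the constant nonnegative, pay for the normalisation
    \<open>G 0 = 0\<close> and make the inequality strict.\<close>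
  define C' where "C' = \<bar>C\<bar> + norm (F 0) + 1"
  have C': "C' > 0" by (simp add: C'_def add_nonneg_pos)
  define G where "G = (\<lambda>t. F t - F 0)"
  have G: "G holomorphic_on UNIV" unfolding G_def by (intro holomorphic_intros F)
  have ReG: "Re (G t) < C' * (1 + norm t) ^ N" for t
  proof -
    have one: "1 \<le> (1 + norm t) ^ N" by (rule one_le_power) simp
    have "C * (1 + norm t) ^ N \<le> \<bar>C\<bar> * (1 + norm t) ^ N"
      by (intro mult_right_mono) auto
    moreover have "norm (F 0) * 1 \<le> norm (F 0) * (1 + norm t) ^ N"
      using one by (intro mult_left_mono) auto
    moreover have "- Re (F 0) \<le> norm (F 0)" using abs_Re_le_cmod[of "F 0"] by linarith
    ultimately show ?thesis using Re[of t] one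
      unfolding G_def C'_def distrib_right minus_complex.sel by linarith
  qed
  have "norm (G t) \<le> 2 * C' * 4 ^ N * norm t ^ N" if t: "norm t \<ge> 1" for t
  proof -
    have "norm (G t) \<le> 2 * (C' * (1 + 2 * norm t) ^ N)"
    proof (rule Borel_Caratheodory_half_radius[OF G, of "2 * norm t"])
      fix z :: complex assume "norm z < 2 * norm t"
      then have "C' * (1 + norm z) ^ N \<le> C' * (1 + 2 * norm t) ^ N"
        using C' by (intro mult_left_mono power_mono) auto
      then show "Re (G z) < C' * (1 + 2 * norm t) ^ N" using ReG[of z] by linarith
    qed (use t in \<open>auto simp: G_def\<close>)
    also have "\<dots> \<le> 2 * (C' * (4 * norm t) ^ N)"
      using C' t by (intro mult_left_mono power_mono) auto
    finally show ?thesis by (simp add: power_mult_distrib mult_ac)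
  qed
  then have Gt: "G t = (\<Sum>k\<le>N. (deriv ^^ k) G 0 / fact k * t ^ k)" for t
    by (rule Liouville_polynomial[OF G])
  have Ft: "F t = F 0 + G t" for t by (simp add: G_def)
  have eq: "F t = poly ([:F 0:] + (\<Sum>k\<le>N. monom ((deriv ^^ k) G 0 / fact k) k)) t" for t
    by (subst Ft, subst Gt) (simp add: poly_sum poly_monom)
  show ?thesis
  proof (rule that[OF _ eq])
    show "degree ([:F 0:] + (\<Sum>k\<le>N. monom ((deriv ^^ k) G 0 / fact k) k)) \<le> N"
      by (intro degree_add_le degree_sum_le) (auto intro: order_trans[OF degree_monom_le])
  qed
qed

section \<open>From polynomials in each variable to polynomials on
  \<open>complex ^ 'n\<close>\<close>

lemma Lagrange_basis:
  obtains L :: "nat \<Rightarrow> complex poly"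
  where "\<And>u t. degree u \<le> N \<Longrightarrow> poly u t = (\<Sum>k\<le>N. poly u (of_nat k) * poly (L k) t)"
proof -
  define W where "W = (\<lambda>k. \<Prod>j\<in>{..N} - {k}. [:- of_nat j, 1:] :: complex poly)"
  define L where "L = (\<lambda>k. smult (inverse (poly (W k) (of_nat k))) (W k))"
  have Wk: "poly (W k) (of_nat k) \<noteq> 0" for k by (auto simp: W_def poly_prod)
  have Wj: "poly (W k) (of_nat j) = 0" if "j \<le> N" "j \<noteq> k" for j k
    using that by (auto simp: W_def poly_prod)
  have dW: "degree (W k) \<le> N" if "k \<le> N" for k
  proof -
    have "degree (W k) \<le> (\<Sum>j\<in>{..N} - {k}. 1)"
      unfolding W_def by (rule order_trans[OF degree_prod_sum_le]) auto
    then show ?thesis using that by simp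
  qed
  show ?thesis
  proof (rule that[of L])
    fix u :: "complex poly" and t assume u: "degree u \<le> N"
    \<comment> \<open>Both sides have degree at most \<open>N\<close> and agree at the
      \<open>Suc N\<close> nodes 0, ..., \<open>N\<close>.\<close>
    have "u = (\<Sum>k\<le>N. smult (poly u (of_nat k)) (L k))"
    proof (rule poly_eqI_degree[of "of_nat ` {..N}"])
      show "poly u x = poly (\<Sum>k\<le>N. smult (poly u (of_nat k)) (L k)) x"
        if x: "x \<in> of_nat ` {..N}" for x
      proof -
        obtain j where j: "j \<le> N" "x = of_nat j" using x by auto
        have "poly u (of_nat k) * poly (L k) x = (if k = j then poly u x else 0)" for k
          using j Wk Wj by (auto simp: L_def)
        then show ?thesis using j by (simp add: poly_sum)
      qed
      have "card (of_nat ` {..N} :: complex set) = Suc N"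
        by (subst card_image) (auto simp: inj_on_def)
      moreover have "degree (\<Sum>k\<le>N. smult (poly u (of_nat k)) (L k)) \<le> N"
        by (intro degree_sum_le) (auto simp: L_def intro!: order_trans[OF degree_smult_le] dW)
      ultimately show "degree u < card (of_nat ` {..N} :: complex set)"
        "degree (\<Sum>k\<le>N. smult (poly u (of_nat k)) (L k)) < card (of_nat ` {..N} :: complex set)"
        using u by simp_all
    qed
    then have "poly u t = poly (\<Sum>k\<le>N. smult (poly u (of_nat k)) (L k)) t" by (rule arg_cong)
    then show "poly u t = (\<Sum>k\<le>N. poly u (of_nat k) * poly (L k) t)" by (simp add: poly_sum)
  qed
qed

definition update_component :: "complex ^ 'n \<Rightarrow> 'n \<Rightarrow> complex \<Rightarrow> complex ^ 'n" where
  "update_component z i t = (\<chi> j. if j = i then t else z $ j)"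

lemma update_component_nth [simp]: "update_component z i t $ j = (if j = i then t else z $ j)"
  by (simp add: update_component_def)

lemma update_component_line: "update_component z i t = update_component z i 0 + t *s axis i 1"
  by (simp add: vec_eq_iff axis_def)

text \<open>Lagrange interpolation in one variable after the other.\<close>

lemma separately_polynomial_imp_polynomial_fun:
  fixes h :: "complex ^ 'n \<Rightarrow> complex"
  assumes "finite I"
    and "\<And>z i. \<exists>u. degree u \<le> N \<and> (\<forall>t. h (update_component z i t) = poly u t)"
    and "\<And>z w. (\<And>i. i \<in> I \<Longrightarrow> z $ i = w $ i) \<Longrightarrow> h z = h w"
  shows "polynomial_fun h"
  using assms
proof (induction I arbitrary: h rule: finite_induct)
  case empty
  then have "h = (\<lambda>_. h 0)" by (intro ext) blast
  then show ?case by (metis polynomial_fun_const)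
next
  case (insert i I)
  obtain L :: "nat \<Rightarrow> complex poly"
    where L: "\<And>u t. degree u \<le> N \<Longrightarrow> poly u t = (\<Sum>k\<le>N. poly u (of_nat k) * poly (L k) t)"
    using Lagrange_basis by blast
  have eq: "h z = (\<Sum>k\<le>N. h (update_component z i (of_nat k)) * poly (L k) (z $ i))" for z
  proof -
    obtain u where u: "degree u \<le> N" "\<And>t. h (update_component z i t) = poly u t"
      using insert.prems(1) by blast
    have "h z = h (update_component z i (z $ i))"
      by (rule arg_cong[of _ _ h]) (simp add: vec_eq_iff)
    also have "\<dots> = poly u (z $ i)" by (rule u(2))
    also have "\<dots> = (\<Sum>k\<le>N. poly u (of_nat k) * poly (L k) (z $ i))" by (rule L[OF u(1)])
    finally show ?thesis by (simp only: u(2))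
  qed
  \<comment> \<open>Fixing coordinate \<open>i\<close> at \<open>s\<close> removes the dependence on
    it and preserves the degree bound in the other coordinates, so the induction hypothesis applies
    to the slice.\<close>
  have hk: "polynomial_fun (\<lambda>z. h (update_component z i s))" for s
  proof (rule insert.IH)
    fix z j
    show "\<exists>u. degree u \<le> N \<and> (\<forall>t. h (update_component (update_component z j t) i s) = poly u t)"
    proof (cases "j = i")
      case True
      have "update_component (update_component z j t) i s = update_component z i s" for t
        using True by (simp add: vec_eq_iff)
      then show ?thesis by (intro exI[of _ "[:h (update_component z i s):]"]) simp
    next
      case False
      then have "update_component (update_component z j t) i s
          = update_component (update_component z i s) j t" for t
        by (simp add: vec_eq_iff)
      then show ?thesis using insert.prems(1) by presburger
    qed
  next
    fix z w :: "complex ^ 'n"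
    assume "\<And>j. j \<in> I \<Longrightarrow> z $ j = w $ j"
    then show "h (update_component z i s) = h (update_component w i s)"
      by (intro insert.prems(2)) auto
  qed
  have "polynomial_fun (\<lambda>z::complex ^ 'n. poly (L k) (z $ i))" for k
    unfolding poly_altdef
    by (intro polynomial_fun_sum polynomial_fun_mult polynomial_fun_const polynomial_fun_power
        polynomial_fun_component)
  with hk have "polynomial_fun (\<lambda>z. \<Sum>k\<le>N. h (update_component z i (of_nat k)) * poly (L k) (z $ i))"
    by (intro polynomial_fun_sum polynomial_fun_mult)
  then show ?case unfolding eq[symmetric] .
qed

text \<open>On a coordinate line the constant depends on the base point but the exponent
  \<open>N\<close> does not, and this uniform degree is what interpolation requires.\<close>

lemma entire_Re_bounded_imp_polynomial_fun:
  fixes h :: "complex ^ 'n \<Rightarrow> complex"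
  assumes h: "entire h" and Re: "\<And>z. Re (h z) \<le> C * (1 + norm z) ^ N"
  shows "polynomial_fun h"
proof (rule separately_polynomial_imp_polynomial_fun[of UNIV N])
  fix z :: "complex ^ 'n" and i
  define a where "a = update_component z i 0"
  define e :: "complex ^ 'n" where "e = axis i 1"
  have hol: "(\<lambda>t. h (a + t *s e)) holomorphic_on UNIV" by (rule entire_on_line[OF h])
  have "Re (h (a + t *s e)) \<le> \<bar>C\<bar> * (1 + norm a + norm e) ^ N * (1 + norm t) ^ N" for t
  proof -
    have "norm (t *s e) = norm t * norm e"
      by (simp add: norm_vec_def norm_mult L2_set_left_distrib flip: L2_set_right_distrib)
    then have "norm (a + t *s e) \<le> norm a + norm t * norm e"
      using norm_triangle_ineq[of a "t *s e"] by simp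
    also have "1 + \<dots> \<le> (1 + norm a + norm e) * (1 + norm t)"
      by (simp add: algebra_simps)
    finally have le: "1 + norm (a + t *s e) \<le> (1 + norm a + norm e) * (1 + norm t)" by simp
    have "Re (h (a + t *s e)) \<le> C * (1 + norm (a + t *s e)) ^ N" by (rule Re)
    also have "\<dots> \<le> \<bar>C\<bar> * (1 + norm (a + t *s e)) ^ N" by (intro mult_right_mono) auto
    also have "\<dots> \<le> \<bar>C\<bar> * ((1 + norm a + norm e) * (1 + norm t)) ^ N"
      using le by (intro mult_left_mono power_mono) auto
    finally show ?thesis by (simp add: power_mult_distrib mult_ac)
  qed
  then obtain u where "degree u \<le> N" "\<And>t. h (a + t *s e) = poly u t"
    using entire_Re_bounded_imp_polynomial[OF hol] by blast
  then show "\<exists>u. degree u \<le> N \<and> (\<forall>t. h (update_component z i t) = poly u t)"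
    by (subst update_component_line) (auto simp: a_def e_def)
next
  fix z w :: "complex ^ 'n" assume "\<And>i. i \<in> UNIV \<Longrightarrow> z $ i = w $ i"
  then have "z = w" by (simp add: vec_eq_iff)
  then show "h z = h w" by simp
qed simp

lemma entire_poly_growth_imp_polynomial_fun:
  assumes "entire h" "poly_growth h" shows "polynomial_fun h"
proof -
  obtain C N where "\<And>z. norm (h z) \<le> C * (1 + norm z) ^ N"
    using assms(2) poly_growthE by blast
  then show ?thesis
    by (intro entire_Re_bounded_imp_polynomial_fun[OF assms(1)] order_trans[OF complex_Re_le_cmod])
qed

section \<open>Exponential growth and polynomial exponents\<close>

definition exp_growth :: "('a::real_normed_vector \<Rightarrow> complex) \<Rightarrow> bool" where
  "exp_growth F \<longleftrightarrow> (\<exists>C N. \<forall>z. norm (F z) \<le> exp (C * (1 + norm z) ^ N))"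

lemma exp_growthI:
  assumes "poly_growth B" "\<And>z. norm (F z) \<le> exp (B z)"
  shows "exp_growth F"
proof -
  obtain C N where C: "\<And>z. norm (B z) \<le> C * (1 + norm z) ^ N"
    using assms(1) poly_growthE by blast
  have "norm (F z) \<le> exp (C * (1 + norm z) ^ N)" for z
  proof -
    have "B z \<le> C * (1 + norm z) ^ N" using C[of z] by simp
    then have "exp (B z) \<le> exp (C * (1 + norm z) ^ N)" by simp
    with assms(2)[of z] show ?thesis by (rule order_trans)
  qed
  then show ?thesis unfolding exp_growth_def by blast
qed

lemma exp_growthE:
  assumes "exp_growth F"
  obtains B :: "'a::real_normed_vector \<Rightarrow> real"
  where "poly_growth B" "\<And>z. norm (F z) \<le> exp (B z)" "\<And>z. B z \<ge> 0"
proof -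
  obtain C N where *: "\<And>z. norm (F z) \<le> exp (C * (1 + norm z) ^ N)"
    using assms unfolding exp_growth_def by blast
  show ?thesis
  proof (rule that[of "\<lambda>z. \<bar>C\<bar> * (1 + norm z) ^ N"])
    show "poly_growth (\<lambda>z::'a. \<bar>C\<bar> * (1 + norm z) ^ N)" by (intro poly_growth_intros)
    have "C * (1 + norm z) ^ N \<le> \<bar>C\<bar> * (1 + norm z) ^ N" for z :: 'a
      by (intro mult_right_mono) auto
    then show "norm (F z) \<le> exp (\<bar>C\<bar> * (1 + norm z) ^ N)" for z
      using *[of z] by (meson exp_le_cancel_iff order_trans)
  qed simp
qed

lemma exp_growth_poly_growth:
  assumes "poly_growth F" shows "exp_growth F"
proof (rule exp_growthI)
  show "poly_growth (\<lambda>z. norm (F z))" by (intro poly_growth_intros assms)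
  show "norm (F z) \<le> exp (norm (F z))" for z using exp_ge_add_one_self[of "norm (F z)"] by linarith
qed

lemma exp_growth_add:
  assumes "exp_growth F" "exp_growth G" shows "exp_growth (\<lambda>z. F z + G z)"
proof -
  obtain A where A: "poly_growth A" "\<And>z. norm (F z) \<le> exp (A z)" "\<And>z. A z \<ge> 0"
    using exp_growthE[OF assms(1)] by blast
  obtain B where B: "poly_growth B" "\<And>z. norm (G z) \<le> exp (B z)" "\<And>z. B z \<ge> 0"
    using exp_growthE[OF assms(2)] by blast
  show ?thesis
  proof (rule exp_growthI)
    \<comment> \<open>The summand 1 absorbs the factor 2 of the sum, as e >= 2.\<close>
    show "poly_growth (\<lambda>z. 1 + A z + B z)" by (intro poly_growth_intros A B)
    fix z
    have "norm (F z + G z) \<le> exp (A z) + exp (B z)"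
      using norm_triangle_le add_mono[OF A(2) B(2)] by blast
    also have "\<dots> \<le> exp (A z + B z) + exp (A z + B z)"
      using A(3)[of z] B(3)[of z] by (intro add_mono) auto
    also have "\<dots> \<le> exp 1 * exp (A z + B z)"
      using exp_ge_add_one_self[of 1] mult_right_mono[of 2 "exp 1" "exp (A z + B z)"] by simp
    finally show "norm (F z + G z) \<le> exp (1 + A z + B z)" by (simp add: exp_add mult_ac)
  qed
qed

lemma exp_growth_mult:
  assumes "exp_growth F" "exp_growth G" shows "exp_growth (\<lambda>z. F z * G z)"
proof -
  obtain A where A: "poly_growth A" "\<And>z. norm (F z) \<le> exp (A z)" "\<And>z. A z \<ge> 0"
    using exp_growthE[OF assms(1)] by blast
  obtain B where B: "poly_growth B" "\<And>z. norm (G z) \<le> exp (B z)" "\<And>z. B z \<ge> 0"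
    using exp_growthE[OF assms(2)] by blast
  show ?thesis
  proof (rule exp_growthI)
    show "poly_growth (\<lambda>z. A z + B z)" by (intro poly_growth_intros A B)
    show "norm (F z * G z) \<le> exp (A z + B z)" for z
      unfolding norm_mult exp_add using A B by (intro mult_mono) auto
  qed
qed

lemma exp_growth_power: "exp_growth F \<Longrightarrow> exp_growth (\<lambda>z. F z ^ k)"
  by (induction k) (auto intro: exp_growth_mult exp_growth_poly_growth poly_growth_const)

lemma exp_growth_sum:
  "(\<And>i. i \<in> A \<Longrightarrow> exp_growth (F i)) \<Longrightarrow> exp_growth (\<lambda>z. \<Sum>i\<in>A. F i z)"
  by (induction A rule: infinite_finite_induct)
     (auto intro: exp_growth_add exp_growth_poly_growth poly_growth_const)

text \<open>With the base \<open>1 + norm z\<close> powers increase with the exponent, so the real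
  order \<open>\<rho>\<close> can be rounded up to an integer; the factor \<open>C\<close> goes into
  the exponent because C <= exp(C).\<close>

lemma exp_growth_finite_order:
  assumes "finite_order f" shows "exp_growth f"
proof -
  obtain C \<rho> where C: "C > 0" "\<rho> > 0" "\<And>z. norm (f z) \<le> C * exp (norm z powr \<rho>)"
    using assms unfolding finite_order_def by blast
  define N where "N = nat \<lceil>\<rho>\<rceil>"
  show ?thesis
  proof (rule exp_growthI)
    show "poly_growth (\<lambda>z::complex ^ 'a. C + (1 + norm z) ^ N)" by (intro poly_growth_intros)
    fix z :: "complex ^ 'a"
    have "norm z powr \<rho> \<le> (1 + norm z) powr \<rho>" using C(2) by (intro powr_mono2) auto
    also have "\<dots> \<le> (1 + norm z) powr N" unfolding N_def by (intro powr_mono) (linarith, simp)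
    also have "\<dots> = (1 + norm z) ^ N" by (intro powr_realpow) (simp add: add_pos_nonneg)
    finally have "exp (norm z powr \<rho>) \<le> exp ((1 + norm z) ^ N)" by simp
    moreover have "C \<le> exp C" using exp_ge_add_one_self[of C] by linarith
    ultimately have "C * exp (norm z powr \<rho>) \<le> exp C * exp ((1 + norm z) ^ N)"
      using C(1) by (intro mult_mono) auto
    then show "norm (f z) \<le> exp (C + (1 + norm z) ^ N)"
      using C(3)[of z] by (simp add: exp_add)
  qed
qed

lemma entire_exp:
  assumes "entire p" shows "entire (\<lambda>z. exp (p z))"
  unfolding entire_def
proof
  fix z
  obtain D where D: "(p has_derivative D) (at z)" "\<forall>c v. D (c *s v) = c * D v"
    using assms unfolding entire_def by blast
  have "((\<lambda>z. exp (p z)) has_derivative (\<lambda>v. exp (p z) * D v)) (at z)"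
    using has_derivative_compose[OF D(1), of exp "\<lambda>x. exp (p z) * x"] DERIV_exp[of "p z"]
    unfolding has_field_derivative_def by simp
  then show "\<exists>D. ((\<lambda>z. exp (p z)) has_derivative D) (at z) \<and> (\<forall>c v. D (c *s v) = c * D v)"
    using D(2) by (intro exI[of _ "\<lambda>v. exp (p z) * D v"]) simp
qed

text \<open>The modulus of exp(p) at \<open>z\<close> is bounded by that of S exp(p) at a point
  within a fixed distance. Taking logarithms, Re p grows at most polynomially.\<close>

lemma polynomial_fun_exponent:
  fixes S p :: "complex ^ 'n \<Rightarrow> complex"
  assumes S: "polynomial_fun S" "S \<noteq> (\<lambda>_. 0)" and p: "entire p"
    and gr: "exp_growth (\<lambda>z. S z * exp (p z))"
  shows "polynomial_fun p"
proof -
  obtain C N where CN: "\<And>z. norm (S z * exp (p z)) \<le> exp (C * (1 + norm z) ^ N)"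
    using gr unfolding exp_growth_def by blast
  obtain K r where K: "K \<ge> 0" "\<And>h z. entire h \<Longrightarrow>
      \<exists>w. norm (w - z) \<le> r \<and> norm (h z) \<le> K * norm (S w * h w)"
    using entire_le_polynomial_multiple[OF S] by blast
  have KK: "K \<le> exp K" using exp_ge_add_one_self[of K] by linarith
  \<comment> \<open>The first summand accounts for moving from \<open>z\<close> to \<open>w\<close>,
    the second for the factor \<open>K\<close> once it has been taken into the exponent.\<close>
  define A where "A = \<bar>C\<bar> * (1 + \<bar>r\<bar>) ^ N + K"
  have "Re (p z) \<le> A * (1 + norm z) ^ N" for z
  proof -
    obtain w where w: "norm (w - z) \<le> r" "norm (exp (p z)) \<le> K * norm (S w * exp (p w))"
      using K(2)[OF entire_exp[OF p]] by blast
    have "norm w \<le> norm z + \<bar>r\<bar>" using w(1) norm_triangle_ineq[of z "w - z"] by simp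
    moreover have "(1 + \<bar>r\<bar>) * (1 + norm z) = 1 + \<bar>r\<bar> + norm z + \<bar>r\<bar> * norm z"
      by (simp add: algebra_simps)
    moreover have "0 \<le> \<bar>r\<bar> * norm z" by simp
    ultimately have "1 + norm w \<le> (1 + \<bar>r\<bar>) * (1 + norm z)" by linarith
    then have "(1 + norm w) ^ N \<le> ((1 + \<bar>r\<bar>) * (1 + norm z)) ^ N"
      by (intro power_mono) auto
    then have "\<bar>C\<bar> * (1 + norm w) ^ N \<le> \<bar>C\<bar> * ((1 + \<bar>r\<bar>) ^ N * (1 + norm z) ^ N)"
      unfolding power_mult_distrib by (intro mult_left_mono) auto
    moreover have "C * (1 + norm w) ^ N \<le> \<bar>C\<bar> * (1 + norm w) ^ N"
      by (intro mult_right_mono) auto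
    ultimately have le: "C * (1 + norm w) ^ N \<le> \<bar>C\<bar> * (1 + \<bar>r\<bar>) ^ N * (1 + norm z) ^ N"
      by (simp add: mult.assoc)
    have "exp (Re (p z)) \<le> K * exp (C * (1 + norm w) ^ N)"
      using w(2) mult_left_mono[OF CN[of w] K(1)] by simp
    also have "\<dots> \<le> exp K * exp (\<bar>C\<bar> * (1 + \<bar>r\<bar>) ^ N * (1 + norm z) ^ N)"
      using le KK by (intro mult_mono) auto
    finally have "Re (p z) \<le> K + \<bar>C\<bar> * (1 + \<bar>r\<bar>) ^ N * (1 + norm z) ^ N"
      by (simp flip: exp_add)
    moreover have "K * 1 \<le> K * (1 + norm z) ^ N"
      using K(1) by (intro mult_left_mono one_le_power) auto
    ultimately show ?thesis by (simp add: A_def distrib_right)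
  qed
  then show ?thesis by (rule entire_Re_bounded_imp_polynomial_fun[OF p])
qed

section \<open>Rational functions\<close>

lemma mero_of_add:
  "entire f \<Longrightarrow> entire g \<Longrightarrow> mero_of (\<lambda>z. f z + g z) = mero_of f + mero_of g"
  by (simp add: mero_of_def plus_entire_fun.abs_eq eq_onp_same_args)

lemma mero_of_mult:
  "entire f \<Longrightarrow> entire g \<Longrightarrow> mero_of (\<lambda>z. f z * g z) = mero_of f * mero_of g"
  by (simp add: mero_of_def times_entire_fun.abs_eq eq_onp_same_args)

lemma mero_of_uminus: "entire f \<Longrightarrow> mero_of (\<lambda>z. - f z) = - mero_of f"
  by (simp add: mero_of_def uminus_entire_fun.abs_eq eq_onp_same_args)

lemma mero_of_0: "mero_of (\<lambda>_. 0) = 0"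
  by (simp add: mero_of_def Zero_fract_def zero_entire_fun_def)

lemma mero_of_1: "mero_of (\<lambda>_. 1) = 1"
  by (simp add: mero_of_def One_fract_def one_entire_fun_def)

lemma mero_of_eq_0_iff: "entire f \<Longrightarrow> mero_of f = 0 \<longleftrightarrow> f = (\<lambda>_. 0)"
  using mero_of_eq_iff[OF _ entire_const[of 0]] by (simp add: mero_of_0)

lemma mero_of_power: "entire f \<Longrightarrow> mero_of (\<lambda>z. f z ^ k) = mero_of f ^ k"
  by (induction k) (simp_all add: mero_of_1 mero_of_mult entire_power)

lemma mero_of_sum:
  "(\<And>i. i \<in> A \<Longrightarrow> entire (f i)) \<Longrightarrow> mero_of (\<lambda>z. \<Sum>i\<in>A. f i z) = (\<Sum>i\<in>A. mero_of (f i))"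
  by (induction A rule: infinite_finite_induct) (simp_all add: mero_of_0 mero_of_add entire_sum)

lemma mero_of_nat: "mero_of (\<lambda>_. of_nat n) = of_nat n"
proof (induction n)
  case (Suc n)
  then show ?case by (simp add: mero_of_1 mero_of_add entire_const)
qed (simp add: mero_of_0)

text \<open>Characteristic zero of the field of meromorphic functions, which allows the division by
  the degree in the Tschirnhaus shift.\<close>

lemma mero_of_nat_neq_0: "of_nat (Suc n) \<noteq> (0 :: 'n::finite mero)"
  using mero_of_eq_0_iff[OF entire_const[of "of_nat (Suc n)"]]
  by (simp add: mero_of_nat fun_eq_iff del: of_nat_Suc)

lemma polynomial_fun_mult_nonzero:
  assumes "polynomial_fun a" "polynomial_fun b" "a \<noteq> (\<lambda>_. 0)" "b \<noteq> (\<lambda>_. 0)"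
  shows "(\<lambda>z. a z * b z) \<noteq> (\<lambda>_. 0)"
  using entire_no_zero_divisors[of a b] assms entire_polynomial_fun by (metis (no_types, lifting))

lemma rational_funsI:
  "polynomial_fun a \<Longrightarrow> polynomial_fun b \<Longrightarrow> b \<noteq> (\<lambda>_. 0) \<Longrightarrow> x = mero_of a / mero_of b
    \<Longrightarrow> x \<in> rational_funs"
  unfolding rational_funs_def by blast

lemma rational_funsE:
  assumes "x \<in> rational_funs"
  obtains a b where "polynomial_fun a" "polynomial_fun b" "b \<noteq> (\<lambda>_. 0)" "mero_of b \<noteq> 0"
    "x = mero_of a / mero_of b"
  using assms mero_of_eq_0_iff entire_polynomial_fun unfolding rational_funs_def by blast

lemma rational_funs_polynomial: "polynomial_fun a \<Longrightarrow> mero_of a \<in> rational_funs"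
  by (rule rational_funsI[of a "\<lambda>_. 1"]) (auto simp: mero_of_1 fun_eq_iff intro: polynomial_fun_const)

lemma rational_funs_0: "0 \<in> rational_funs"
  using rational_funs_polynomial[OF polynomial_fun_const[of 0]] by (simp add: mero_of_0)

lemma rational_funs_of_nat: "of_nat n \<in> rational_funs"
  using rational_funs_polynomial[OF polynomial_fun_const[of "of_nat n"]] by (simp add: mero_of_nat)

lemma rational_funs_mult:
  assumes "x \<in> rational_funs" "y \<in> rational_funs" shows "x * y \<in> rational_funs"
proof -
  obtain a b where ab: "polynomial_fun a" "polynomial_fun b" "b \<noteq> (\<lambda>_. 0)" "mero_of b \<noteq> 0"
    "x = mero_of a / mero_of b" using rational_funsE[OF assms(1)] .
  obtain c d where cd: "polynomial_fun c" "polynomial_fun d" "d \<noteq> (\<lambda>_. 0)" "mero_of d \<noteq> 0"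
    "y = mero_of c / mero_of d" using rational_funsE[OF assms(2)] .
  have nz: "(\<lambda>z. b z * d z) \<noteq> (\<lambda>_. 0)"
    using ab cd by (intro polynomial_fun_mult_nonzero)
  show ?thesis
    by (rule rational_funsI[of "\<lambda>z. a z * c z" "\<lambda>z. b z * d z"])
       (use ab cd nz in \<open>auto intro!: polynomial_fun_mult
          simp: mero_of_mult entire_polynomial_fun\<close>)
qed

lemma rational_funs_add:
  assumes "x \<in> rational_funs" "y \<in> rational_funs" shows "x + y \<in> rational_funs"
proof -
  obtain a b where ab: "polynomial_fun a" "polynomial_fun b" "b \<noteq> (\<lambda>_. 0)" "mero_of b \<noteq> 0"
    "x = mero_of a / mero_of b" using rational_funsE[OF assms(1)] .
  obtain c d where cd: "polynomial_fun c" "polynomial_fun d" "d \<noteq> (\<lambda>_. 0)" "mero_of d \<noteq> 0"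
    "y = mero_of c / mero_of d" using rational_funsE[OF assms(2)] .
  have nz: "(\<lambda>z. b z * d z) \<noteq> (\<lambda>_. 0)"
    using ab cd by (intro polynomial_fun_mult_nonzero)
  show ?thesis
    by (rule rational_funsI[of "\<lambda>z. a z * d z + c z * b z" "\<lambda>z. b z * d z"])
       (use ab cd nz in \<open>auto intro!: polynomial_fun_mult polynomial_fun_add
          simp: mero_of_mult mero_of_add entire_mult entire_polynomial_fun add_frac_eq\<close>)
qed

lemma rational_funs_uminus: "x \<in> rational_funs \<Longrightarrow> - x \<in> rational_funs"
  using rational_funs_mult[of "mero_of (\<lambda>_. - 1)" x]
    rational_funs_polynomial[OF polynomial_fun_const[of "- 1"]]
  by (simp add: mero_of_uminus mero_of_1 entire_const)

lemma rational_funs_inverse: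
  assumes "x \<in> rational_funs" shows "inverse x \<in> rational_funs"
proof -
  obtain a b where ab: "polynomial_fun a" "polynomial_fun b" "b \<noteq> (\<lambda>_. 0)" "mero_of b \<noteq> 0"
    "x = mero_of a / mero_of b" using rational_funsE[OF assms] .
  show ?thesis
  proof (cases "a = (\<lambda>_. 0)")
    case True
    then show ?thesis using ab rational_funs_0 by (simp add: mero_of_0)
  next
    case False
    then show ?thesis using ab by (intro rational_funsI[of b a]) auto
  qed
qed

lemma rational_funs_divide:
  "x \<in> rational_funs \<Longrightarrow> y \<in> rational_funs \<Longrightarrow> x / y \<in> rational_funs"
  unfolding divide_inverse by (intro rational_funs_mult rational_funs_inverse)

lemma rational_funs_sum:
  "(\<And>i. i \<in> A \<Longrightarrow> f i \<in> rational_funs) \<Longrightarrow> sum f A \<in> rational_funs"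
  by (induction A rule: infinite_finite_induct) (auto intro: rational_funs_0 rational_funs_add)

lemma rational_funs_coeff_mult:
  assumes "\<And>i. coeff P i \<in> rational_funs" "\<And>i. coeff Q i \<in> rational_funs"
  shows "coeff (P * Q) i \<in> rational_funs"
  unfolding coeff_mult by (intro rational_funs_sum rational_funs_mult assms)

lemma rational_funs_coeff_pcompose:
  assumes "\<And>i. coeff P i \<in> rational_funs" "\<And>i. coeff Q i \<in> rational_funs"
  shows "coeff (pcompose P Q) i \<in> rational_funs"
  using assms(1)
proof (induction P arbitrary: i)
  case (pCons a P)
  have "coeff P i \<in> rational_funs" for i using pCons.prems[of "Suc i"] by simp
  then have "coeff (Q * pcompose P Q) i \<in> rational_funs"
    using pCons.IH assms(2) by (intro rational_funs_coeff_mult) auto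
  moreover have "coeff [:a:] i \<in> rational_funs"
    using pCons.prems[of 0] rational_funs_0 by (cases i) auto
  ultimately show ?case by (simp only: pcompose_pCons coeff_add rational_funs_add)
qed (simp add: rational_funs_0)

text \<open>The product of the individual denominators serves; it is built up one element at a
  time.\<close>

lemma rational_funs_common_denominator:
  assumes "finite X" "X \<subseteq> rational_funs"
  obtains q where "polynomial_fun q" "q \<noteq> (\<lambda>_. 0)"
    "\<And>x. x \<in> X \<Longrightarrow> \<exists>a. polynomial_fun a \<and> mero_of q * x = mero_of a"
proof -
  have "\<exists>q. polynomial_fun q \<and> q \<noteq> (\<lambda>_. 0) \<and> (\<forall>x\<in>X. \<exists>a. polynomial_fun a \<and> mero_of q * x = mero_of a)"
    using assms
  proof (induction X rule: finite_induct)
    case empty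
    show ?case by (intro exI[of _ "\<lambda>_. 1"]) (auto simp: fun_eq_iff intro: polynomial_fun_const)
  next
    case (insert y X)
    then obtain q where q: "polynomial_fun q" "q \<noteq> (\<lambda>_. 0)"
      "\<And>x. x \<in> X \<Longrightarrow> \<exists>a. polynomial_fun a \<and> mero_of q * x = mero_of a" by blast
    obtain c d where cd: "polynomial_fun c" "polynomial_fun d" "d \<noteq> (\<lambda>_. 0)" "mero_of d \<noteq> 0"
      "y = mero_of c / mero_of d" using rational_funsE insert.prems by blast
    have qd: "mero_of (\<lambda>z. q z * d z) = mero_of q * mero_of d"
      using q cd by (intro mero_of_mult entire_polynomial_fun)
    have "\<exists>a. polynomial_fun a \<and> mero_of (\<lambda>z. q z * d z) * x = mero_of a" if x: "x \<in> insert y X" for x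
    proof (cases "x = y")
      case True
      have "mero_of (\<lambda>z. q z * d z) * y = mero_of (\<lambda>z. q z * c z)"
        using cd q by (simp add: qd mero_of_mult entire_polynomial_fun)
      then show ?thesis using True polynomial_fun_mult[OF q(1) cd(1)] by blast
    next
      case False
      then obtain a where a: "polynomial_fun a" "mero_of q * x = mero_of a" using q(3) x by blast
      have "mero_of (\<lambda>z. q z * d z) * x = mero_of q * x * mero_of d"
        unfolding qd by (simp only: mult_ac)
      also have "\<dots> = mero_of (\<lambda>z. a z * d z)"
        using a cd by (simp add: mero_of_mult entire_polynomial_fun)
      finally show ?thesis using polynomial_fun_mult[OF a(1) cd(2)] by blast
    qed
    then show ?case
      using polynomial_fun_mult[OF q(1) cd(2)] polynomial_fun_mult_nonzero[OF q(1) cd(2) q(2) cd(3)]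
      by blast
  qed
  then show ?thesis using that by blast
qed

section \<open>Shifting the variable of a polynomial\<close>

lemma coeff_pcompose_shift:
  fixes P :: "'a::field poly"
  assumes "degree P = Suc m"
  shows "coeff (pcompose P [:- b, 1:]) m = coeff P m - of_nat (Suc m) * b * coeff P (Suc m)"
proof -
  \<comment> \<open>Only the two highest powers of the shifted variable reach degree
    \<open>m\<close>, so the coefficient there depends affinely on \<open>b\<close>.\<close>
  have c: "coeff ([:- b, 1:] ^ i) m = 0" if "i < m" for i
    using that by (intro coeff_eq_0) (simp add: degree_linear_power)
  have "pcompose P [:- b, 1:] = (\<Sum>i\<le>Suc m. smult (coeff P i) ([:- b, 1:] ^ i))"
    unfolding pcompose_altdef poly_altdef by (simp add: degree_map_poly coeff_map_poly assms)
  then have "coeff (pcompose P [:- b, 1:]) m = (\<Sum>i\<le>Suc m. coeff P i * coeff ([:- b, 1:] ^ i) m)"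
    by (simp add: coeff_sum)
  also have "\<dots> = (\<Sum>i<m. coeff P i * coeff ([:- b, 1:] ^ i) m)
      + coeff P m * coeff ([:- b, 1:] ^ m) m + coeff P (Suc m) * coeff ([:- b, 1:] ^ Suc m) m"
    by (simp add: lessThan_Suc_atMost[symmetric] del: power_Suc)
  also have "(\<Sum>i<m. coeff P i * coeff ([:- b, 1:] ^ i) m) = 0"
    by (intro sum.neutral) (simp add: c)
  also have "coeff ([:- b, 1:] ^ m) m = 1" by (rule coeff_linear_power)
  also have "coeff ([:- b, 1:] ^ Suc m) m = - (of_nat (Suc m) * b)"
    by (subst coeff_linear_poly_power) simp_all
  finally show ?thesis by (simp add: algebra_simps)
qed

text \<open>Composition with the inverse shift undoes the Tschirnhaus transformation.\<close>

lemma eq_shifted_power: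
  fixes P :: "'a::field poly"
  assumes "pcompose P [:- b, 1:] = smult a (monom 1 n)"
  shows "P = smult a ([:b, 1:] ^ n)"
proof -
  have "pcompose [:- b, 1:] [:b, 1:] = [:0, 1:]" by (simp add: pcompose_pCons)
  then have "P = pcompose (pcompose P [:- b, 1:]) [:b, 1:]"
    by (simp flip: pcompose_assoc)
  also have "\<dots> = smult a (pcompose (monom 1 n) [:b, 1:])"
    unfolding assms by (rule pcompose_smult)
  also have "pcompose (monom 1 n) [:b, 1:] = [:b, 1:] ^ n"
    by (induction n) (simp_all add: pcompose_mult pcompose_1 monom_Suc pcompose_pCons monom_0 one_pCons)
  finally show ?thesis .
qed

section \<open>Relations with an exponential, reduced to complex lines\<close>

lemma exponent_varies_off_zeros:
  fixes S p :: "complex ^ 'n \<Rightarrow> complex"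
  assumes "entire S" "S \<noteq> (\<lambda>_. 0)" "entire p" "\<not> p constant_on UNIV"
  obtains w where "S w \<noteq> 0" "p w \<noteq> p z"
proof -
  have "(\<lambda>x. p x - p z) \<noteq> (\<lambda>_. 0)"
    using assms(4) unfolding constant_on_def by (metis eq_iff_diff_eq_0)
  then have "\<exists>w. S w * (p w - p z) \<noteq> 0"
    using entire_no_zero_divisors[of S "\<lambda>x. p x - p z"] assms(1-3)
      entire_diff[OF assms(3) entire_const] by blast
  then show ?thesis using that by auto
qed

lemma polynomial_fun_line:
  fixes q :: "complex ^ 'n \<Rightarrow> complex"
  assumes "polynomial_fun q"
  shows "\<exists>u. \<forall>t. q (z + t *s v) = poly u t"
proof -
  obtain d c where c: "\<And>z. q z = (\<Sum>\<alpha>\<in>multi_indices d. c \<alpha> * (\<Prod>i\<in>UNIV. (z $ i) ^ \<alpha> i))"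
    using assms polynomial_funE by blast
  obtain u where "\<And>t. q (z + t *s v) = poly u t" using polynomial_fun_on_line[OF c, of z v] by blast
  then show ?thesis by blast
qed

text \<open>This excludes constant \<open>P\<close>. The growth of \<open>A\<close> forces
  \<open>p\<close> to be a polynomial; on a line where \<open>S\<close> is not identically zero and
  \<open>p\<close> varies, S exp(p) then outgrows every polynomial.\<close>

lemma exp_not_rational:
  fixes S p A :: "complex ^ 'n \<Rightarrow> complex"
  assumes S: "polynomial_fun S" "S \<noteq> (\<lambda>_. 0)" and p: "entire p" "\<not> p constant_on UNIV"
    and A: "polynomial_fun A" and eq: "\<And>z. A z = S z * exp (p z)"
  shows False
proof -
  have "exp_growth (\<lambda>z. S z * exp (p z))"
    using exp_growth_poly_growth[OF poly_growth_polynomial_fun[OF A]] by (simp flip: eq)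
  then have pp: "polynomial_fun p" by (rule polynomial_fun_exponent[OF S p(1)])
  obtain w where w: "S w \<noteq> 0" "p w \<noteq> p 0"
    using exponent_varies_off_zeros[OF entire_polynomial_fun[OF S(1)] S(2) p] by blast
  obtain a where a: "\<And>t. A (0 + t *s w) = poly a t" using polynomial_fun_line[OF A] by blast
  obtain s where s: "\<And>t. S (0 + t *s w) = poly s t" using polynomial_fun_line[OF S(1)] by blast
  obtain q where q: "\<And>t. p (0 + t *s w) = poly q t" using polynomial_fun_line[OF pp] by blast
  have "poly s 1 \<noteq> 0" using w(1) s[of 1] by simp
  then have "s \<noteq> 0" by auto
  moreover have "poly a t = poly s t * exp (poly q t)" for t
    using eq[of "0 + t *s w"] by (simp only: a s q)
  then have "poly_growth (\<lambda>t. poly s t * exp (poly q t))"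
    using poly_growth_poly[of a] by (simp only:)
  ultimately have "degree q = 0" using poly_mult_exp_not_poly_growth by blast
  moreover have "poly q 1 \<noteq> poly q 0" using w(2) q[of 1] q[of 0] by simp
  ultimately show False by (auto elim!: degree_eq_zeroE)
qed

text \<open>Each \<open>z\<close> is joined by a line to a point \<open>w\<close> with
  \<open>S w \<noteq> 0\<close> and \<open>p w \<noteq> p z\<close>. The one-variable theorem holds
  on this line, and its parameter 0 gives the assertion at \<open>z\<close>.\<close>

theorem monic_relation_with_exponential_Cn:
  fixes g S p :: "complex ^ 'n \<Rightarrow> complex" and b :: "nat \<Rightarrow> complex ^ 'n \<Rightarrow> complex"
  assumes g: "entire g" and S: "polynomial_fun S" "S \<noteq> (\<lambda>_. 0)"
    and p: "polynomial_fun p" "\<not> p constant_on UNIV"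
    and b: "\<And>i. i < m \<Longrightarrow> polynomial_fun (b i)"
    and eq: "\<And>z. g z ^ Suc m + (\<Sum>i<m. b i z * g z ^ i) = S z * exp (p z)"
  shows "i < m \<Longrightarrow> b i z = 0"
proof -
  assume i: "i < m"
  obtain w where w: "S w \<noteq> 0" "p w \<noteq> p z"
    using exponent_varies_off_zeros[OF entire_polynomial_fun[OF S(1)] S(2) entire_polynomial_fun[OF p(1)] p(2)]
    by blast
  define l where "l = (\<lambda>t. z + t *s (w - z))"
  have l: "l 0 = z" "l 1 = w" by (simp_all add: l_def)
  obtain s where s: "\<And>t. S (l t) = poly s t" using polynomial_fun_line[OF S(1)] unfolding l_def by blast
  obtain q where q: "\<And>t. p (l t) = poly q t" using polynomial_fun_line[OF p(1)] unfolding l_def by blast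
  have "\<exists>u. \<forall>t. b i (l t) = poly u t" if "i < m" for i
    using polynomial_fun_line[OF b[OF that]] unfolding l_def by blast
  then obtain u where u: "\<And>i t. i < m \<Longrightarrow> b i (l t) = poly (u i) t" by metis
  \<comment> \<open>The coefficients on the line, completed by the missing coefficient 0 in degree
    \<open>m\<close> and the leading coefficient 1 in degree \<open>Suc m\<close>.\<close>
  define c where "c = (\<lambda>i. if i < m then u i else if i = m then 0 else 1)"
  have "c i = 0"
  proof (rule monic_relation_with_exponential[of "\<lambda>t. g (l t)" c m s q])
    show "(\<lambda>t. g (l t)) holomorphic_on UNIV" unfolding l_def by (rule entire_on_line[OF g])
    show "(\<Sum>i\<le>Suc m. poly (c i) t * g (l t) ^ i) = poly s t * exp (poly q t)" for t
    proof -
      have "(\<Sum>i\<le>Suc m. poly (c i) t * g (l t) ^ i)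
          = g (l t) ^ Suc m + (\<Sum>i<m. poly (c i) t * g (l t) ^ i)"
        by (simp add: c_def lessThan_Suc_atMost[symmetric])
      also have "(\<Sum>i<m. poly (c i) t * g (l t) ^ i) = (\<Sum>i<m. b i (l t) * g (l t) ^ i)"
        by (intro sum.cong refl) (simp add: c_def u)
      finally show ?thesis by (simp only: eq s q)
    qed
    have "poly s 1 \<noteq> 0" using w(1) s[of 1] by (simp add: l)
    then show "s \<noteq> 0" by auto
    have "poly q 1 \<noteq> poly q 0" using w(2) q[of 1] q[of 0] by (simp add: l)
    then show "degree q > 0" by (metis degree_eq_zeroE gr0I poly_const_conv)
  qed (use i in \<open>auto simp: c_def\<close>)
  then show "b i z = 0" using u[OF i, of 0] i by (simp add: c_def l)
qed

lemma total_degree_pos: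
  fixes p :: "complex ^ 'n \<Rightarrow> complex"
  assumes "polynomial_fun p" "\<not> p constant_on UNIV" shows "total_degree p \<ge> 1"
proof (rule ccontr)
  assume "\<not> ?thesis"
  then have "total_degree p = 0" by simp
  moreover have "poly_deg_le (total_degree p) p"
    using assms(1) unfolding polynomial_fun_def total_degree_def by (rule LeastI_ex)
  ultimately obtain c where c: "\<And>z. p z = (\<Sum>\<alpha>\<in>multi_indices 0. c \<alpha> * (\<Prod>i\<in>UNIV. (z $ i) ^ \<alpha> i))"
    unfolding poly_deg_le_def by auto
  have "(multi_indices 0 :: ('n \<Rightarrow> nat) set) = {\<lambda>_. 0}" by (auto simp: multi_indices_def)
  then have "p z = c (\<lambda>_. 0)" for z using c[of z] by simp
  then show False using assms(2) unfolding constant_on_def by blast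
qed

theorem theorem4p1:
  fixes f p :: "complex ^ 'n \<Rightarrow> complex"
    and P :: "'n mero poly"
    and R :: "'n mero"
  assumes "transcendental f"
    and "finite_order f"
    and "\<forall>i. coeff P i \<in> rational_funs"
    and "R \<in> rational_funs" and "R \<noteq> 0"
    and "entire p" and "\<not> p constant_on UNIV"
    and "poly P (mero_of f) = R * mero_of (\<lambda>z. exp (p z))"
  shows "polynomial_fun p \<and> total_degree p \<ge> 1 \<and>
    (\<exists>m::nat. m \<ge> 1 \<and> (\<exists>p1 \<in> rational_funs. \<exists>p2 \<in> rational_funs. p2 \<noteq> 0 \<and>
       P = smult (R * p2 ^ m) ([:p1, 1:] ^ m) \<and>
       mero_of f = inverse p2 * mero_of (\<lambda>z. exp (p z / of_nat m)) - p1))"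
proof -
  define F where "F = mero_of f"
  define E where "E = mero_of (\<lambda>z. exp (p z))"
  have ef: "entire f" using assms(1) by (simp add: transcendental_def)
  have eE: "entire (\<lambda>z. exp (p z))" by (rule entire_exp[OF assms(6)])
  have E0: "E \<noteq> 0"
    unfolding E_def mero_of_eq_0_iff[OF eE] by (metis exp_not_eq_zero)
  have PF: "poly P F = R * E" using assms(8) by (simp add: F_def E_def)
  define a where "a = lead_coeff P"
  have P0: "P \<noteq> 0" using PF assms(5) E0 by auto
  have a: "a \<noteq> 0" "a \<in> rational_funs" using P0 assms(3) by (auto simp: a_def)
  have Ra: "R / a \<in> rational_funs" "R / a \<noteq> 0"
    using a assms(4,5) by (auto intro: rational_funs_divide)

  \<comment> \<open>Positive degree of \<open>P\<close>\<close>
  have "degree P \<noteq> 0"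
  proof
    assume "degree P = 0"
    then have "P = [:a:]" unfolding a_def
      by (metis degree_eq_zeroE lead_coeff_pCons pCons_0_0)
    then have ar: "a = R * E" using PF by simp
    \<comment> \<open>One polynomial clears both denominators, so that \<open>a = R * E\<close>
      equates a polynomial with a nonzero polynomial times exp(p).\<close>
    obtain q where q: "polynomial_fun q" "q \<noteq> (\<lambda>_. 0)"
      "\<And>x. x \<in> {a, R} \<Longrightarrow> \<exists>b. polynomial_fun b \<and> mero_of q * x = mero_of b"
      using rational_funs_common_denominator[of "{a, R}"] a(2) assms(4) by auto
    obtain A where A: "polynomial_fun A" "mero_of q * a = mero_of A" using q(3)[of a] by auto
    obtain S where S: "polynomial_fun S" "mero_of q * R = mero_of S" using q(3)[of R] by auto
    have "mero_of S \<noteq> 0"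
      using S(2) q(1,2) assms(5) by (metis mero_of_eq_0_iff entire_polynomial_fun mult_eq_0_iff)
    then have S0: "S \<noteq> (\<lambda>_. 0)" using mero_of_0 by blast
    have "mero_of A = mero_of (\<lambda>z. S z * exp (p z))"
      using A(2) S(2) ar mero_of_mult[OF entire_polynomial_fun[OF S(1)] eE]
      by (simp add: E_def mult.assoc[symmetric])
    then have "A = (\<lambda>z. S z * exp (p z))"
      using mero_of_eq_iff entire_polynomial_fun[OF A(1)] entire_mult[OF entire_polynomial_fun[OF S(1)] eE]
      by blast
    then have "A z = S z * exp (p z)" for z by (rule fun_cong)
    then show False by (rule exp_not_rational[OF S(1) S0 assms(6,7) A(1)])
  qed
  then obtain m where m: "degree P = Suc m" using not0_implies_Suc by blast

  \<comment> \<open>Tschirnhaus shift and clearing of denominators\<close>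
  define D where "D = Suc m"
  \<comment> \<open>The shift for which the coefficient of degree \<open>m\<close> in P(w - p1)
    cancels.\<close>
  define p1 where "p1 = coeff P m / (of_nat (Suc m) * a)"
  have p1: "p1 \<in> rational_funs"
    unfolding p1_def
    by (intro rational_funs_divide rational_funs_mult rational_funs_of_nat a(2) assms(3)[rule_format])
  define Q where "Q = pcompose P [:- p1, 1:]"
  have dQ: "degree Q = Suc m" by (simp add: Q_def degree_pcompose m)
  have lQ: "coeff Q (Suc m) = a"
    using lead_coeff_comp[of "[:- p1, 1:]" P] by (simp add: Q_def degree_pcompose m a_def)
  have Qm: "coeff Q m = 0"
    using coeff_pcompose_shift[OF m, of p1] a mero_of_nat_neq_0[of m, where ?'n = 'n]
    by (simp add: Q_def p1_def a_def m del: of_nat_Suc)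
  have Qr: "coeff Q i \<in> rational_funs" for i
    unfolding Q_def
  proof (rule rational_funs_coeff_pcompose)
    show "coeff [:- p1, 1:] i \<in> rational_funs" for i
      using rational_funs_uminus[OF p1] rational_funs_of_nat[of 1] rational_funs_0
      by (auto simp: coeff_pCons split: nat.split)
  qed (use assms(3) in blast)
  \<comment> \<open>Everything that must become polynomial: the shift, the right-hand factor and the
    coefficients after division by the leading one.\<close>
  define X where "X = insert p1 (insert (R / a) ((\<lambda>i. coeff Q i / a) ` {..m}))"
  have X: "finite X" "X \<subseteq> rational_funs"
    unfolding X_def using p1 Ra Qr a by (auto intro: rational_funs_divide)
  obtain q where q: "polynomial_fun q" "q \<noteq> (\<lambda>_. 0)"
    "\<And>x. x \<in> X \<Longrightarrow> \<exists>b. polynomial_fun b \<and> mero_of q * x = mero_of b"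
    using rational_funs_common_denominator[OF X] by blast
  define q' where "q' = mero_of q"
  have q'0: "q' \<noteq> 0" using q(1,2) by (simp add: q'_def mero_of_eq_0_iff entire_polynomial_fun)
  obtain r where r: "polynomial_fun r" "q' * p1 = mero_of r"
    using q(3)[of p1] by (auto simp: X_def q'_def)
  obtain s where s: "polynomial_fun s" "q' * (R / a) = mero_of s"
    using q(3)[of "R / a"] by (auto simp: X_def q'_def)
  have "\<exists>b. polynomial_fun b \<and> q' * (coeff Q i / a) = mero_of b" if "i < m" for i
  proof -
    have "coeff Q i / a \<in> X" unfolding X_def using that by (intro insertI2 imageI) simp
    then show ?thesis unfolding q'_def by (rule q(3))
  qed
  then have "\<forall>i. \<exists>b. i < m \<longrightarrow> polynomial_fun b \<and> q' * (coeff Q i / a) = mero_of b" by blast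
  from choice[OF this] obtain e where e: "\<And>i. i < m \<Longrightarrow> polynomial_fun (e i)"
    "\<And>i. i < m \<Longrightarrow> q' * (coeff Q i / a) = mero_of (e i)" by blast
  note ent = entire_polynomial_fun[OF q(1)] entire_polynomial_fun[OF r(1)]
    entire_polynomial_fun[OF s(1)]
  define g where "g = (\<lambda>z. q z * f z + r z)"
  have eg: "entire g" unfolding g_def by (intro entire_add entire_mult ent ef)
  have g': "mero_of g = q' * (F + p1)"
    using r(2) by (simp add: g_def mero_of_add mero_of_mult entire_mult ent ef q'_def F_def distrib_left)
  \<comment> \<open>Multiplying the monic equation for \<open>F + p1\<close> by
    \<open>q' ^ Suc m\<close> turns its powers into powers of \<open>g\<close> and leaves
    \<open>q' ^ (Suc m - i)\<close> at the \<open>i\<close>-th coefficient. One factor clears the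
    denominator in \<open>e i\<close>, the other \<open>m - i\<close> remain; likewise for
    \<open>S\<close>.\<close>
  define b where "b = (\<lambda>i z. q z ^ (m - i) * e i z)"
  define S where "S = (\<lambda>z. q z ^ m * s z)"
  have pb: "polynomial_fun (b i)" if "i < m" for i
    unfolding b_def using e(1)[OF that] q(1) by (intro polynomial_fun_mult polynomial_fun_power)
  have pS: "polynomial_fun S"
    unfolding S_def by (intro polynomial_fun_mult polynomial_fun_power q s)
  have S': "mero_of S = q' ^ Suc m * (R / a)"
    using s(2) by (simp add: S_def mero_of_mult mero_of_power entire_power ent q'_def[symmetric]
        mult.assoc mult.left_commute flip: s(2))
  have S0: "S \<noteq> (\<lambda>_. 0)"
  proof
    assume "S = (\<lambda>_. 0)"
    then have "mero_of S = 0" by (simp add: mero_of_0)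
    then show False using S' q'0 Ra(2) by simp
  qed

  \<comment> \<open>The monic relation for \<open>g\<close>\<close>
  have "mero_of (\<lambda>z. g z ^ Suc m + (\<Sum>i<m. b i z * g z ^ i)) = mero_of (\<lambda>z. S z * exp (p z))"
  proof -
    have b': "mero_of (b i) = q' ^ (m - i) * (q' * (coeff Q i / a))" if "i < m" for i
      using e[OF that] unfolding b_def
      by (simp add: mero_of_mult mero_of_power entire_power ent entire_polynomial_fun q'_def)
    have eb: "entire (\<lambda>z. b i z * g z ^ i)" if "i < m" for i
      using pb[OF that] by (intro entire_mult entire_power eg entire_polynomial_fun)
    have "mero_of (\<lambda>z. \<Sum>i<m. b i z * g z ^ i) = (\<Sum>i<m. mero_of (\<lambda>z. b i z * g z ^ i))"
      using eb by (intro mero_of_sum) simp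
    also have "\<dots> = (\<Sum>i<m. mero_of (b i) * mero_of g ^ i)"
      using pb eg
      by (intro sum.cong refl) (simp add: mero_of_mult mero_of_power entire_power entire_polynomial_fun)
    finally have "mero_of (\<lambda>z. g z ^ Suc m + (\<Sum>i<m. b i z * g z ^ i))
        = mero_of g ^ Suc m + (\<Sum>i<m. mero_of (b i) * mero_of g ^ i)"
      using eb by (subst mero_of_add) (auto simp del: power_Suc simp add: mero_of_power eg
          intro!: entire_sum entire_power)
    also have "\<dots> = q' ^ Suc m * ((F + p1) ^ Suc m + (\<Sum>i<m. (coeff Q i / a) * (F + p1) ^ i))"
    proof -
      have summand: "mero_of (b i) * mero_of g ^ i = q' ^ Suc m * ((coeff Q i / a) * (F + p1) ^ i)" if "i < m" for i
      proof -
        have "q' ^ Suc m = q' ^ (m - i) * q' * q' ^ i"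
          using that by (simp flip: power_add power_Suc2)
        then show ?thesis
          unfolding b'[OF that] g' power_mult_distrib by (simp only: mult_ac)
      qed
      have "(\<Sum>i<m. mero_of (b i) * mero_of g ^ i)
          = q' ^ Suc m * (\<Sum>i<m. (coeff Q i / a) * (F + p1) ^ i)"
        unfolding sum_distrib_left by (intro sum.cong refl summand) simp
      moreover have "mero_of g ^ Suc m = q' ^ Suc m * (F + p1) ^ Suc m"
        unfolding g' by (rule power_mult_distrib)
      ultimately show ?thesis by (simp only: distrib_left)
    qed
    also have "(F + p1) ^ Suc m + (\<Sum>i<m. (coeff Q i / a) * (F + p1) ^ i) = poly Q (F + p1) / a"
    proof -
      have "poly Q (F + p1) = a * (F + p1) ^ Suc m + (\<Sum>i<m. coeff Q i * (F + p1) ^ i)"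
        unfolding poly_altdef dQ by (simp add: lQ Qm lessThan_Suc_atMost[symmetric] del: power_Suc)
      then show ?thesis
        using a(1) by (simp add: add_divide_distrib sum_divide_distrib del: power_Suc)
    qed
    also have "poly Q (F + p1) = R * E" by (simp add: Q_def poly_pcompose PF)
    also have "q' ^ Suc m * (R * E / a) = mero_of S * E" by (simp add: S')
    also have "\<dots> = mero_of (\<lambda>z. S z * exp (p z))"
      unfolding E_def by (rule mero_of_mult[symmetric, OF entire_polynomial_fun[OF pS] eE])
    finally show ?thesis .
  qed
  moreover have "entire (\<lambda>z. g z ^ Suc m + (\<Sum>i<m. b i z * g z ^ i))"
    using pb by (intro entire_add entire_sum entire_mult entire_power eg) (auto intro: entire_polynomial_fun)
  \<comment> \<open>Both sides are entire, so equality in the field of fractions is equality of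
    functions.\<close>
  ultimately have "(\<lambda>z. g z ^ Suc m + (\<Sum>i<m. b i z * g z ^ i)) = (\<lambda>z. S z * exp (p z))"
    using mero_of_eq_iff entire_mult[OF entire_polynomial_fun[OF pS] eE] by blast
  then have eq: "g z ^ Suc m + (\<Sum>i<m. b i z * g z ^ i) = S z * exp (p z)" for z
    by (rule fun_cong)

  \<comment> \<open>Polynomiality of \<open>p\<close> and vanishing of the lower
    coefficients\<close>
  have "exp_growth g"
    unfolding g_def
    by (intro exp_growth_add exp_growth_mult exp_growth_poly_growth poly_growth_polynomial_fun
        q r exp_growth_finite_order assms(2))
  then have "exp_growth (\<lambda>z. g z ^ Suc m + (\<Sum>i<m. b i z * g z ^ i))"
    by (intro exp_growth_add exp_growth_sum exp_growth_mult exp_growth_power)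
       (auto intro: exp_growth_poly_growth poly_growth_polynomial_fun pb)
  \<comment> \<open>Through the relation, the finite order of \<open>f\<close> has passed to S
    exp(p).\<close>
  then have pp: "polynomial_fun p"
    unfolding eq by (rule polynomial_fun_exponent[OF pS S0 assms(6)])
  have b0: "b i z = 0" if "i < m" for i z
    using monic_relation_with_exponential_Cn[OF eg pS S0 pp assms(7) pb eq that] by blast
  have "coeff Q i = 0" if i: "i < m" for i
  proof -
    have "mero_of (b i) = q' ^ (m - i) * (q' * (coeff Q i / a))"
      using e[OF i] unfolding b_def
      by (simp add: mero_of_mult mero_of_power entire_power ent entire_polynomial_fun q'_def)
    moreover have "b i = (\<lambda>_. 0)" using b0[OF i] by (intro ext)
    then have "mero_of (b i) = 0" by (simp add: mero_of_0)
    ultimately show ?thesis using q'0 a(1) by simp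
  qed
  then have "coeff Q i = coeff (smult a (monom 1 (Suc m))) i" for i
    using lQ Qm dQ by (cases i "Suc m" rule: linorder_cases) (auto simp: coeff_eq_0 less_Suc_eq)
  then have "Q = smult a (monom 1 (Suc m))" by (rule poly_eqI)
  then have P: "P = smult a ([:p1, 1:] ^ Suc m)" unfolding Q_def by (rule eq_shifted_power)

  \<comment> \<open>The polynomial root \<open>h\<close> and the resulting formulas\<close>
  define h where "h = (\<lambda>z. g z * exp (- (p z / of_nat (Suc m))))"
  have gS: "g z ^ Suc m = S z * exp (p z)" for z using eq[of z] b0 by simp
  have ed: "entire (\<lambda>z. p z / of_nat (Suc m))"
    using entire_mult[OF assms(6) entire_const, of "inverse (of_nat (Suc m))"] by (simp add: divide_inverse)
  have eh: "entire h"
    unfolding h_def by (intro entire_mult eg entire_exp entire_uminus ed)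
  have hS: "h z ^ Suc m = S z" for z
  proof -
    have "exp (- (p z / of_nat (Suc m))) ^ Suc m = exp (- p z)"
      unfolding exp_of_nat_mult[symmetric] by (simp del: of_nat_Suc)
    then show ?thesis
      unfolding h_def power_mult_distrib gS by (simp add: mult.assoc flip: exp_add)
  qed
  have "poly_growth h"
    by (rule poly_growth_root[OF poly_growth_polynomial_fun[OF pS] hS]) simp
  then have ph: "polynomial_fun h" by (rule entire_poly_growth_imp_polynomial_fun[OF eh])
  define h' where "h' = mero_of h"
  have hS': "h' ^ Suc m = q' ^ Suc m * (R / a)"
  proof -
    have "h' ^ Suc m = mero_of (\<lambda>z. h z ^ Suc m)"
      unfolding h'_def by (rule mero_of_power[OF eh, symmetric])
    then show ?thesis by (simp only: hS S')
  qed
  then have h'0: "h' \<noteq> 0" using q'0 Ra(2) by (metis mult_eq_0_iff power_not_zero zero_neq_one power_0_Suc)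
  \<comment> \<open>Since \<open>h' ^ Suc m = q' ^ Suc m * (R / a)\<close>, this quotient satisfies
    \<open>R * p2 ^ Suc m = a\<close>. Moreover, its inverse is the factor left when
    \<open>q' * (F + p1)\<close>, which equals \<open>h'\<close> times the exponential, is divided
    by \<open>q'\<close>.\<close>
  define p2 where "p2 = q' / h'"
  have p2: "p2 \<in> rational_funs" "p2 \<noteq> 0"
    using q'0 h'0 rational_funs_polynomial[OF q(1)] rational_funs_polynomial[OF ph]
    by (auto simp: p2_def q'_def h'_def intro: rational_funs_divide)
  have Rp2: "R * p2 ^ Suc m = a"
  proof -
    have "R * p2 ^ Suc m = R * q' ^ Suc m / (q' ^ Suc m * (R / a))"
      unfolding p2_def power_divide hS' by simp
    then show ?thesis using q'0 assms(5) a(1) by (simp add: field_simps del: power_Suc)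
  qed
  have "g = (\<lambda>z. h z * exp (p z / of_nat (Suc m)))"
    by (auto simp: h_def mult.assoc simp flip: exp_add)
  then have "mero_of g = h' * mero_of (\<lambda>z. exp (p z / of_nat (Suc m)))"
    unfolding h'_def using mero_of_mult[OF eh entire_exp[OF ed]] by simp
  then have "F = inverse p2 * mero_of (\<lambda>z. exp (p z / of_nat (Suc m))) - p1"
    using q'0 g' by (simp add: p2_def field_simps del: of_nat_Suc)
  then have "mero_of f = inverse p2 * mero_of (\<lambda>z. exp (p z / of_nat (Suc m))) - p1"
    by (simp only: F_def)
  moreover have "P = smult (R * p2 ^ Suc m) ([:p1, 1:] ^ Suc m)" using P Rp2 by simp
  ultimately show ?thesis
    using pp total_degree_pos[OF pp assms(7)] p1 p2
    by (intro conjI exI[of _ "Suc m"] bexI[of _ p1] bexI[of _ p2]) auto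
qed

end
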